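(* Let $E$ be a (possibly infinite) set and let $U,V\subseteq\mathbb{C}^E$ be finite-dimensional linear subspaces, neither contained in a coordinate hyperplane. Let $M=\mathcal{M}(U)$ and $N=\mathcal{M}(V)$ be their algebraic matroids, with rank functions $r_M,r_N$. Then $\mathcal{M}(U\star V)=\mathcal{M}(r_M+r_N-1)$.
   Context: For a polynomial map $f:\mathbb{C}^F\to\mathbb{C}^E$ with $F$ finite and $W$ the Zariski closure of its image, the algebraic matroid $\mathcal{M}(W)$ on ground set $E$ has as independent sets the $I\subseteq E$ with $\dim\pi_I(W)=|I|$, where $\pi_I$ is the coordinate projection to $\mathbb{C}^I$ (finite-dimensional linear and affine spaces are of this form). The Hadamard product of $x,y\in\mathbb{C}^E$ is $(x\star y)_e=x_ey_e$; for varieties, $U\star V$ is the Zariski closure of $\{x\star y: x\in U, y\in V\}$. For $f:2^E\to\mathbb{Z}$ submodular, monotone ($S\subseteq T\Rightarrow f(S)\le f(T)$) and bounded above, $\mathcal{M}(f)$ is the matroid on $E$ whose independent sets are $\emptyset$ and the sets $I$ with $|I'|\le f(I')$ for every nonempty $I'\subseteq I$. *)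

theory Defs
  imports "HOL-Analysis.Abstract_Topology" "HOL-Library.Function_Algebras"
    "HOL-Library.Extended_Nat"
begin

section \<open>Affine and linear coordinate spaces\<close>

text \<open>
  The space \<open>\<complex>\<^sup>S\<close> is represented by the functions that vanish outside \<open>S\<close>, so that all these
  spaces, for subsets \<open>S\<close> of a common index type (\<open>S\<close> may be empty or infinite), are linear
  subspaces of one complex vector space.
\<close>

definition cspace :: "'e set \<Rightarrow> ('e \<Rightarrow> complex) set" where
  "cspace S = {x. \<forall>e. e \<notin> S \<longrightarrow> x e = 0}"

definition cscale :: "complex \<Rightarrow> ('e \<Rightarrow> complex) \<Rightarrow> 'e \<Rightarrow> complex" where
  "cscale c x = (\<lambda>e. c * x e)"

interpretation cvec: vector_space "cscale :: complex \<Rightarrow> ('e \<Rightarrow> complex) \<Rightarrow> 'e \<Rightarrow> complex"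
  by unfold_locales (auto simp: cscale_def fun_eq_iff algebra_simps)

definition fin_dim_subspace :: "'e set \<Rightarrow> ('e \<Rightarrow> complex) set \<Rightarrow> bool" where
  "fin_dim_subspace E U \<longleftrightarrow>
     cvec.subspace U \<and> U \<subseteq> cspace E \<and> (\<exists>B. finite B \<and> cvec.span B = U)"

definition coord_hyperplane :: "'e set \<Rightarrow> 'e \<Rightarrow> ('e \<Rightarrow> complex) set" where
  "coord_hyperplane E e = {x \<in> cspace E. x e = 0}"

definition coord_proj :: "'e set \<Rightarrow> ('e \<Rightarrow> complex) \<Rightarrow> 'e \<Rightarrow> complex" where
  "coord_proj I x = (\<lambda>e. if e \<in> I then x e else 0)"


section \<open>The Zariski topology\<close>

text \<open>
  The functions on \<open>\<complex>\<^sup>S\<close> given by the polynomials in \<open>\<complex>[x\<^sub>e | e \<in> S]\<close>; each involves only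
  finitely many of the variables, also for infinite \<open>S\<close>.
\<close>

inductive_set poly_fun :: "'e set \<Rightarrow> (('e \<Rightarrow> complex) \<Rightarrow> complex) set" for S where
  const: "(\<lambda>x. c) \<in> poly_fun S"
| coord: "e \<in> S \<Longrightarrow> (\<lambda>x. x e) \<in> poly_fun S"
| add: "p \<in> poly_fun S \<Longrightarrow> q \<in> poly_fun S \<Longrightarrow> (\<lambda>x. p x + q x) \<in> poly_fun S"
| mult: "p \<in> poly_fun S \<Longrightarrow> q \<in> poly_fun S \<Longrightarrow> (\<lambda>x. p x * q x) \<in> poly_fun S"

definition zero_locus :: "'e set \<Rightarrow> (('e \<Rightarrow> complex) \<Rightarrow> complex) set \<Rightarrow> ('e \<Rightarrow> complex) set" where
  "zero_locus S P = {x \<in> cspace S. \<forall>p\<in>P. p x = 0}"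

definition zariski :: "'e set \<Rightarrow> ('e \<Rightarrow> complex) topology" where
  "zariski S = topology (\<lambda>G. \<exists>P \<subseteq> poly_fun S. G = cspace S - zero_locus S P)"

lemma openin_zariski:
  "openin (zariski S) G \<longleftrightarrow> (\<exists>P \<subseteq> poly_fun S. G = cspace S - zero_locus S P)"
proof -
  let ?O = "\<lambda>G. \<exists>P \<subseteq> poly_fun S. G = cspace S - zero_locus S P"
  have "istopology ?O"
    unfolding istopology_def
  proof (intro conjI allI impI)
    fix G H assume "?O G" "?O H"
    then obtain P Q where P: "P \<subseteq> poly_fun S" "G = cspace S - zero_locus S P"
      and Q: "Q \<subseteq> poly_fun S" "H = cspace S - zero_locus S Q" by blast
    let ?R = "{\<lambda>x. p x * q x | p q. p \<in> P \<and> q \<in> Q}"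
    have "?R \<subseteq> poly_fun S" using P(1) Q(1) by (auto intro: poly_fun.mult)
    moreover have "G \<inter> H = cspace S - zero_locus S ?R"
      unfolding P(2) Q(2) zero_locus_def by fastforce
    ultimately show "?O (G \<inter> H)" by blast
  next
    fix \<K> assume "\<forall>K\<in>\<K>. ?O K"
    then obtain P where P: "\<And>K. K \<in> \<K> \<Longrightarrow> P K \<subseteq> poly_fun S"
      "\<And>K. K \<in> \<K> \<Longrightarrow> K = cspace S - zero_locus S (P K)" by metis
    have "(\<Union>K\<in>\<K>. P K) \<subseteq> poly_fun S" using P(1) by blast
    moreover have "\<Union>\<K> = (\<Union>K\<in>\<K>. cspace S - zero_locus S (P K))" using P(2) by auto
    then have "\<Union>\<K> = cspace S - zero_locus S (\<Union>K\<in>\<K>. P K)"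
      unfolding zero_locus_def by auto
    ultimately show "?O (\<Union>\<K>)" by blast
  qed
  then show ?thesis unfolding zariski_def by (simp add: topology_inverse')
qed

lemma topspace_zariski [simp]: "topspace (zariski S) = cspace S"
proof
  show "topspace (zariski S) \<subseteq> cspace S"
    using openin_topspace[of "zariski S"] unfolding openin_zariski by blast
  have "openin (zariski S) (cspace S)"
    unfolding openin_zariski zero_locus_def
    by (rule exI[of _ "{\<lambda>x. 1}"]) (auto intro: poly_fun.const)
  then show "cspace S \<subseteq> topspace (zariski S)" by (rule openin_subset)
qed

lemma closedin_zariski:
  "closedin (zariski S) Z \<longleftrightarrow> (\<exists>P \<subseteq> poly_fun S. Z = zero_locus S P)"
proof -
  have "zero_locus S P \<subseteq> cspace S" for P by (auto simp: zero_locus_def)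
  then show ?thesis
    unfolding closedin_def openin_zariski topspace_zariski
    by (metis double_diff order_refl Diff_subset)
qed


section \<open>Dimension\<close>

definition irreducible_in :: "'a topology \<Rightarrow> 'a set \<Rightarrow> bool" where
  "irreducible_in X Z \<longleftrightarrow> Z \<noteq> {} \<and> Z \<subseteq> topspace X \<and>
     (\<forall>A B. closedin X A \<and> closedin X B \<and> Z \<subseteq> A \<union> B \<longrightarrow> Z \<subseteq> A \<or> Z \<subseteq> B)"

text \<open>Krull dimension of a topological space; the value for the empty space is \<open>0\<close> here.\<close>

definition krull_dim :: "'a topology \<Rightarrow> enat" where
  "krull_dim X = Sup {enat n | n. \<exists>Z :: nat \<Rightarrow> 'a set.
     (\<forall>i\<le>n. closedin X (Z i) \<and> irreducible_in X (Z i)) \<and> (\<forall>i<n. Z i \<subset> Z (Suc i))}"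

text \<open>
  The image of a variety under a coordinate projection need not be closed; as usual, the dimension
  of an arbitrary subset of \<open>\<complex>\<^sup>S\<close> means the dimension of its Zariski closure.
\<close>

definition zariski_dim :: "'e set \<Rightarrow> ('e \<Rightarrow> complex) set \<Rightarrow> enat" where
  "zariski_dim S A = krull_dim (subtopology (zariski S) (zariski S closure_of A))"


section \<open>Matroids\<close>

text \<open>A matroid is given by its ground set and its family of independent sets.\<close>

type_synonym 'e matroid = "'e set \<times> 'e set set"

definition indep_sets :: "'e matroid \<Rightarrow> 'e set set" where
  "indep_sets M = snd M"

text \<open>Independent sets have bounded size in all matroids considered here, so the maximum exists.\<close>

definition rank_fun :: "'e matroid \<Rightarrow> 'e set \<Rightarrow> int" where
  "rank_fun M S = int (Max {card I | I. I \<in> indep_sets M \<and> I \<subseteq> S})"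

text \<open>
  The finiteness condition expresses that the dimension of the closure of the image of a polynomial
  map \<open>\<complex>\<^sup>F \<rightarrow> \<complex>\<^sup>E\<close> with finite \<open>F\<close> is finite, hence never equal to the size of an infinite set.
\<close>

definition algebraic_matroid :: "'e set \<Rightarrow> ('e \<Rightarrow> complex) set \<Rightarrow> 'e matroid" where
  "algebraic_matroid E W =
     (E, {I. I \<subseteq> E \<and> finite I \<and> zariski_dim I (coord_proj I ` W) = enat (card I)})"

text \<open>
  Intended for submodular, monotone \<open>f\<close> that are bounded above.  An infinite \<open>I\<close> violates the
  inequality for \<open>I' = I\<close>, because \<open>f I\<close> is finite; as \<^const>\<open>card\<close> is \<open>0\<close> on infinite sets, this is
  made explicit.
\<close>

definition submodular_matroid :: "'e set \<Rightarrow> ('e set \<Rightarrow> int) \<Rightarrow> 'e matroid" where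
  "submodular_matroid E f =
     (E, {I. I \<subseteq> E \<and> (I = {} \<or>
            finite I \<and> (\<forall>I'. I' \<subseteq> I \<and> I' \<noteq> {} \<longrightarrow> int (card I') \<le> f I'))})"


section \<open>Hadamard products\<close>

definition hadamard :: "('e \<Rightarrow> complex) \<Rightarrow> ('e \<Rightarrow> complex) \<Rightarrow> 'e \<Rightarrow> complex" where
  "hadamard x y = (\<lambda>e. x e * y e)"

definition hadamard_variety ::
    "'e set \<Rightarrow> ('e \<Rightarrow> complex) set \<Rightarrow> ('e \<Rightarrow> complex) set \<Rightarrow> ('e \<Rightarrow> complex) set" where
  "hadamard_variety E U V = zariski E closure_of {hadamard x y | x y. x \<in> U \<and> y \<in> V}"

end

theory Submission
  imports Defs "HOL-Computational_Algebra.Polynomial" "HOL-Library.FuncSet"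
begin

text \<open>
  A finite set \<open>I\<close> is independent in \<open>\<M>(W)\<close> iff no nonzero polynomial in the coordinates with index in
  \<open>I\<close> vanishes on \<open>W\<close>; for a linear space this is linear independence of the coordinate functionals.

  For \<open>e\<^sub>0 \<in> J\<close>, rescaling \<open>(x, y)\<close> to \<open>x e\<^sub>0 = 1\<close> expresses the coordinates \<open>x e * y e\<close>, \<open>e \<in> J\<close>,
  by \<open>r\<^sub>M(J) + r\<^sub>N(J) - 1\<close> parameters, so the rank condition is necessary.

  Conversely, let \<open>u e\<close> and \<open>v e\<close> be the coordinate functionals of \<open>U\<close> and \<open>V\<close>, and \<open>A e\<close> the plane
  they span in the dual of \<open>U \<oplus> V\<close>. The row \<open>y e * u e + x e * v e\<close> of the Jacobian matrix of the
  Hadamard product spans the intersection of \<open>A e\<close> with the hyperplane given by \<open>(- x, y)\<close>. By Lovasz's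
  argument for Dilworth truncation, the rank condition makes these intersections independent for a
  generic hyperplane. Then the ideal of polynomials vanishing on all \<open>x \<star> y\<close> is closed under partial
  derivatives, and a polynomial all of whose derivatives vanish at a point is zero.
\<close>

section \<open>Generic transversals of planes\<close>

lemma sum_fun_apply: "(\<Sum>i\<in>A. f i) x = (\<Sum>i\<in>A. f i x)"
  for f :: "'i \<Rightarrow> 'a \<Rightarrow> 'b::comm_monoid_add"
  by (induction A rule: infinite_finite_induct) auto

lemma cscale_apply: "cscale c x e = c * x e"
  by (simp add: cscale_def)

text \<open>A subspace that does not contain both \<open>u\<close> and \<open>v\<close> contains
  \<open>u + cscale b v\<close> for at most one \<open>b\<close>, and there are infinitely many
  \<open>b\<close>.\<close>

lemma ex_add_cscale_notin_family:
  assumes "finite F" and "\<And>S. S \<in> F \<Longrightarrow> cvec.subspace S" and "\<And>S. S \<in> F \<Longrightarrow> \<not> (u \<in> S \<and> v \<in> S)"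
  obtains b where "\<And>S. S \<in> F \<Longrightarrow> u + cscale b v \<notin> S"
proof -
  have "finite {b. u + cscale b v \<in> S}" if S: "S \<in> F" for S
  proof -
    have "b = b'" if b: "u + cscale b v \<in> S" "u + cscale b' v \<in> S" for b b'
    proof (rule ccontr)
      assume ne: "b \<noteq> b'"
      have "(u + cscale b v) - (u + cscale b' v) \<in> S"
        using b assms(2)[OF S] by (blast intro: cvec.subspace_diff)
      then have "cscale (inverse (b - b')) ((u + cscale b v) - (u + cscale b' v)) \<in> S"
        using assms(2)[OF S] by (blast intro: cvec.subspace_scale)
      also have "cscale (inverse (b - b')) ((u + cscale b v) - (u + cscale b' v)) = v"
        using ne by (auto simp: cscale_def fun_eq_iff field_simps)
      finally have v: "v \<in> S" .
      have "(u + cscale b v) - cscale b v \<in> S"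
        using b v assms(2)[OF S] by (blast intro: cvec.subspace_diff cvec.subspace_scale)
      then show False using v assms(3)[OF S] by simp
    qed
    then have "\<exists>b. {b. u + cscale b v \<in> S} \<subseteq> {b}" by blast
    then show ?thesis using finite_subset by blast
  qed
  then have "finite (\<Union>S\<in>F. {b. u + cscale b v \<in> S})" using assms(1) by blast
  then obtain b where "b \<notin> (\<Union>S\<in>F. {b. u + cscale b v \<in> S})"
    using ex_new_if_finite infinite_UNIV_char_0 by blast
  then show ?thesis using that by blast
qed

text \<open>A lower bound on the dimension of the span by an independent witness, which makes sense
  for infinite \<open>S\<close> as well.\<close>

definition rank_ge :: "('a \<Rightarrow> complex) set \<Rightarrow> nat \<Rightarrow> bool" where
  "rank_ge S n \<longleftrightarrow> (\<exists>T. finite T \<and> cvec.independent T \<and> T \<subseteq> cvec.span S \<and> n \<le> card T)"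

lemma rank_ge_mono: "rank_ge S n \<Longrightarrow> S \<subseteq> cvec.span S' \<Longrightarrow> rank_ge S' n"
  unfolding rank_ge_def by (meson cvec.span_minimal cvec.subspace_span order_trans)

lemma rank_ge_insert:
  assumes "rank_ge S n" "w \<notin> cvec.span S"
  shows "rank_ge (insert w S) (Suc n)"
proof -
  obtain T where T: "finite T" "cvec.independent T" "T \<subseteq> cvec.span S" "n \<le> card T"
    using assms(1) unfolding rank_ge_def by blast
  have sT: "cvec.span T \<subseteq> cvec.span S" using T(3) by (simp add: cvec.span_minimal)
  then have "w \<notin> cvec.span T" using assms(2) by blast
  then have "cvec.independent (insert w T)" and "w \<notin> T"
    using T(2) by (auto simp: cvec.independent_insert cvec.span_base)
  moreover have "insert w T \<subseteq> cvec.span (insert w S)"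
    using T(3) cvec.span_mono[of S "insert w S"] by (auto intro: cvec.span_base)
  ultimately show ?thesis
    unfolding rank_ge_def using T(1,4) by (intro exI[of _ "insert w T"]) simp
qed

lemma rank_ge_le_card:
  assumes "rank_ge S n" "S \<subseteq> cvec.span S'" "finite S'"
  shows "n \<le> card S'"
proof -
  have "rank_ge S' n" using rank_ge_mono assms by blast
  then obtain T where T: "finite T" "cvec.independent T" "T \<subseteq> cvec.span S'" "n \<le> card T"
    unfolding rank_ge_def by blast
  then show ?thesis using cvec.independent_span_bound[OF assms(3) T(2,3)] by simp
qed

text \<open>Let \<open>A e\<close> be the plane spanned by \<open>u e\<close> and \<open>v e\<close>. This is the geometric core of
  Lovasz's theorem on Dilworth truncation. The planes are replaced by lines one after the other; the
  invariant is that, for \<open>f \<in> J\<close>, the planes and lines with index in \<open>J\<close> together with the whole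
  plane \<open>A f\<close> have rank greater than \<open>card J\<close>. A new line only has to avoid finitely many
  subspaces.\<close>

lemma generic_transversal:
  fixes u v :: "'i \<Rightarrow> 'a \<Rightarrow> complex"
  assumes I: "finite I"
    and rk: "\<And>J. J \<subseteq> I \<Longrightarrow> J \<noteq> {} \<Longrightarrow> rank_ge (u ` J \<union> v ` J) (Suc (card J))"
  obtains b where "\<forall>c. (\<Sum>e\<in>I. cscale (c e) (u e + cscale (b e) (v e))) = 0 \<longrightarrow> (\<forall>e\<in>I. c e = 0)"
    and "\<forall>f\<in>I. \<not> (u f \<in> cvec.span ((\<lambda>e. u e + cscale (b e) (v e)) ` I) \<and>
                            v f \<in> cvec.span ((\<lambda>e. u e + cscale (b e) (v e)) ` I))"
proof -
  define w where "w b e = u e + cscale (b e) (v e)" for b e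
  \<comment> \<open>The generators with index in \<open>J\<close> once the planes with index in
    \<open>T\<close> have been replaced by lines.\<close>
  define B where "B b T J = w b ` (J \<inter> T) \<union> u ` (J - T) \<union> v ` (J - T)" for b T J
  have w_span: "w b e \<in> cvec.span S" if "u e \<in> cvec.span S" "v e \<in> cvec.span S" for b e S
    unfolding w_def using that by (intro cvec.span_add cvec.span_scale)
  have "T \<subseteq> I \<Longrightarrow> \<exists>b. \<forall>J f. J \<subseteq> I \<and> f \<in> J \<longrightarrow> rank_ge (B b T J \<union> {u f, v f}) (Suc (card J))"
    if "finite T" for T
    using that
  proof (induction T)
    case empty
    have "rank_ge (B (\<lambda>_. 0) {} J \<union> {u f, v f}) (Suc (card J))" if "J \<subseteq> I" "f \<in> J" for J f
      by (rule rank_ge_mono[OF rk[of J]]) (use that in \<open>auto simp: B_def intro: cvec.span_base\<close>)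
    then show ?case by blast
  next
    case (insert e T)
    then obtain b where b: "\<And>J f. J \<subseteq> I \<Longrightarrow> f \<in> J \<Longrightarrow> rank_ge (B b T J \<union> {u f, v f}) (Suc (card J))"
      by auto
    \<comment> \<open>The new line has to leave each span that does not already contain the whole
      plane of \<open>e\<close>; there are finitely many pairs \<open>(K, f)\<close>.\<close>
    define F where "F = {S \<in> (\<lambda>(K, f). cvec.span (B b T K \<union> {u f, v f})) ` (Pow I \<times> I).
      \<not> (u e \<in> S \<and> v e \<in> S)}"
    have "finite F" unfolding F_def using I by simp
    moreover have "cvec.subspace S" if "S \<in> F" for S using that unfolding F_def by auto
    ultimately obtain \<beta> where \<beta>: "\<And>S. S \<in> F \<Longrightarrow> u e + cscale \<beta> (v e) \<notin> S"
      using ex_add_cscale_notin_family[of F "u e" "v e"] unfolding F_def by blast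
    define b' where "b' = b(e := \<beta>)"
    have w': "w b' g = w b g" if "g \<noteq> e" for g using that by (simp add: w_def b'_def)
    have wT: "w b' ` (J \<inter> T) = w b ` (J \<inter> T)" for J
      using insert.hyps(2) by (intro image_cong refl w') auto
    have B_notin: "B b' (insert e T) J = B b T J" if "e \<notin> J" for J
    proof -
      have "J \<inter> insert e T = J \<inter> T" "J - insert e T = J - T" using that by auto
      then show ?thesis unfolding B_def using wT by simp
    qed
    have B_in: "B b' (insert e T) J = insert (w b' e) (B b T (J - {e}))"
      "B b T J = {u e, v e} \<union> B b T (J - {e})" if "e \<in> J" for J
    proof -
      have "J \<inter> insert e T = insert e (J \<inter> T)" "J - insert e T = J - {e} - T"
        "J \<inter> T = (J - {e}) \<inter> T" "J - T = insert e (J - {e} - T)"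
        using that insert.hyps(2) by auto
      then show "B b' (insert e T) J = insert (w b' e) (B b T (J - {e}))"
        "B b T J = {u e, v e} \<union> B b T (J - {e})"
        unfolding B_def using wT[of J] by (auto simp del: Int_insert_right Int_insert_left)
    qed
    have "rank_ge (B b' (insert e T) J \<union> {u f, v f}) (Suc (card J))"
      if J: "J \<subseteq> I" "f \<in> J" for J f
    proof (cases "e \<in> J")
      case False
      then show ?thesis using B_notin b J by simp
    next
      case eJ: True
      define K where "K = J - {e}"
      define S where "S = B b T K \<union> {u f, v f}"
      have "finite J" using J I finite_subset by blast
      then have card: "card J = Suc (card K)" using card.remove[OF _ eJ] unfolding K_def by blast
      have S_le: "S \<subseteq> B b' (insert e T) J \<union> {u f, v f}"
        using B_in[OF eJ] unfolding S_def K_def by auto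
      show ?thesis
      proof (cases "u e \<in> cvec.span S \<and> v e \<in> cvec.span S")
        case True
        \<comment> \<open>The other generators already span the plane of \<open>e\<close>, so
          passing to a line loses nothing.\<close>
        show ?thesis
        proof (rule rank_ge_mono[OF b[OF J]])
          have "B b T J \<union> {u f, v f} \<subseteq> cvec.span S"
            using True B_in(2)[OF eJ] unfolding S_def K_def by (auto intro: cvec.span_base)
          then show "B b T J \<union> {u f, v f} \<subseteq> cvec.span (B b' (insert e T) J \<union> {u f, v f})"
            using cvec.span_mono[OF S_le] by blast
        qed
      next
        case False
        \<comment> \<open>For \<open>f = e\<close> the set \<open>S\<close> contains generators of
          the plane of \<open>e\<close>. Otherwise the hypothesis for \<open>K\<close> gives rank
          greater than \<open>card K\<close>, and the new line, chosen outside the span of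
          \<open>S\<close>, adds one.\<close>
        then have "f \<noteq> e" unfolding S_def by (auto intro: cvec.span_base)
        then have fK: "f \<in> K" "K \<subseteq> I" using J unfolding K_def by auto
        have "cvec.span S \<in> F"
          using False fK J unfolding F_def S_def by auto
        then have "w b' e \<notin> cvec.span S" using \<beta> unfolding w_def b'_def by simp
        then have "rank_ge (insert (w b' e) S) (Suc (Suc (card K)))"
          using b[OF fK(2,1)] rank_ge_insert unfolding S_def by blast
        moreover have "insert (w b' e) S = B b' (insert e T) J \<union> {u f, v f}"
          unfolding S_def K_def using B_in(1)[OF eJ] by auto
        ultimately show ?thesis using card by simp
      qed
    qed
    then show ?case by blast
  qed
  from this[OF I order_refl] obtain b
    where "\<And>J f. J \<subseteq> I \<Longrightarrow> f \<in> J \<Longrightarrow> rank_ge (B b I J \<union> {u f, v f}) (Suc (card J))"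
    by blast
  \<comment> \<open>Now all planes are lines: adding any one plane to the lines gives rank greater
    than \<open>card I\<close>.\<close>
  from this[of I] have b: "\<And>f. f \<in> I \<Longrightarrow> rank_ge (w b ` I \<union> {u f, v f}) (Suc (card I))"
    by (simp add: B_def)
  show ?thesis
  proof (rule that[of b]; fold w_def; intro allI impI ballI)
    fix f assume f: "f \<in> I"
    show "\<not> (u f \<in> cvec.span (w b ` I) \<and> v f \<in> cvec.span (w b ` I))"
    proof
      assume "u f \<in> cvec.span (w b ` I) \<and> v f \<in> cvec.span (w b ` I)"
      then have "w b ` I \<union> {u f, v f} \<subseteq> cvec.span (w b ` I)" by (auto intro: cvec.span_base)
      then have "Suc (card I) \<le> card (w b ` I)" using rank_ge_le_card[OF b[OF f]] I by blast
      then show False using card_image_le[OF I, of "w b"] by simp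
    qed
  next
    fix c assume c: "(\<Sum>e\<in>I. cscale (c e) (w b e)) = 0"
    fix f assume f: "f \<in> I"
    show "c f = 0"
    proof (rule ccontr)
      assume "c f \<noteq> 0"
      note f = f this
      \<comment> \<open>If \<open>c f\<close> is nonzero, \<open>w b f\<close> depends on the other
        lines, so these and \<open>v f\<close> span everything, although they are at most
        \<open>card I\<close> vectors.\<close>
      define S where "S = insert (v f) (w b ` (I - {f}))"
      have "w b f = cscale (- inverse (c f)) (\<Sum>e\<in>I - {f}. cscale (c e) (w b e))"
      proof -
        have "cscale (c f) (w b f) = - (\<Sum>e\<in>I - {f}. cscale (c e) (w b e))"
          using c by (simp add: sum.remove[OF I f(1)] add_eq_0_iff2)
        then have "cscale (inverse (c f)) (cscale (c f) (w b f)) =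
            cscale (inverse (c f)) (- (\<Sum>e\<in>I - {f}. cscale (c e) (w b e)))" by simp
        then show ?thesis using f(2)
          by (simp add: cvec.scale_minus_left cvec.scale_minus_right del: cvec.scale_cancel_left)
      qed
      also have "\<dots> \<in> cvec.span S"
        unfolding S_def by (intro cvec.span_scale cvec.span_sum cvec.span_base) auto
      finally have wf: "w b f \<in> cvec.span S" .
      have vf: "v f \<in> cvec.span S" unfolding S_def by (auto intro: cvec.span_base)
      have "u f = w b f - cscale (b f) (v f)" by (simp add: w_def)
      then have uf: "u f \<in> cvec.span S" using wf vf by (simp add: cvec.span_diff cvec.span_scale)
      have "w b ` I \<subseteq> cvec.span S"
      proof
        fix x assume "x \<in> w b ` I"
        then obtain e where "e \<in> I" "x = w b e" by blast
        then show "x \<in> cvec.span S" using wf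
          by (cases "e = f") (auto simp: S_def intro: cvec.span_base)
      qed
      then have "Suc (card I) \<le> card S"
        using rank_ge_le_card[OF b[OF f(1)], of S] uf vf I unfolding S_def by simp
      also have "\<dots> \<le> Suc (card (I - {f}))"
        unfolding S_def using I card_image_le[of "I - {f}" "w b"]
        by (simp add: card_insert_if)
      also have "\<dots> = card I" using card.remove[OF I f(1)] by simp
      finally show False by simp
    qed
  qed
qed

text \<open>Linear functionals on \<open>X\<close>, extended by zero outside \<open>X\<close>, so
  that functionals agreeing on \<open>X\<close> are equal as functions and \<open>cvec.span\<close>
  applies to them.\<close>

definition functional_on :: "('a \<Rightarrow> complex) set \<Rightarrow> (('a \<Rightarrow> complex) \<Rightarrow> complex) \<Rightarrow> bool" where
  "functional_on X g \<longleftrightarrow> (\<forall>x\<in>X. \<forall>y\<in>X. g (x + y) = g x + g y) \<and>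
     (\<forall>x\<in>X. \<forall>c. g (cscale c x) = c * g x) \<and> (\<forall>x. x \<notin> X \<longrightarrow> g x = 0)"

text \<open>Induction on \<open>W\<close>. If \<open>w\<close> is not in the span of
  \<open>W\<close>, some \<open>y\<close> annihilated by \<open>W\<close> has
  \<open>w y \<noteq> 0\<close>; it serves to eliminate \<open>w\<close> from \<open>g\<close> and
  to correct the point found for the remainder.\<close>

lemma functional_separation:
  assumes X: "cvec.subspace X" and "finite W" "\<And>w. w \<in> W \<Longrightarrow> functional_on X w"
    and "functional_on X g" "g \<notin> cvec.span W"
  obtains x where "x \<in> X" "\<forall>w\<in>W. w x = 0" "g x \<noteq> 0"
proof -
  have "\<exists>x\<in>X. (\<forall>w\<in>W. w x = 0) \<and> g x \<noteq> 0"
    using assms(2-)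
  proof (induction W arbitrary: g)
    case empty
    then have "g \<noteq> 0" by simp
    then obtain x where "g x \<noteq> 0" by (auto simp: fun_eq_iff)
    then show ?case using empty unfolding functional_on_def by auto
  next
    case (insert w W)
    show ?case
    proof (cases "w \<in> cvec.span W")
      case True
      then have "g \<notin> cvec.span W"
        using insert.prems(3) cvec.span_redundant by blast
      then obtain x where x: "x \<in> X" "\<forall>w\<in>W. w x = 0" "g x \<noteq> 0" using insert by blast
      have "cvec.subspace {f. f x = (0::complex)}"
        unfolding cvec.subspace_def by (auto simp: cscale_apply)
      then have "cvec.span W \<subseteq> {f. f x = 0}" using x by (intro cvec.span_minimal) auto
      then show ?thesis using x True by auto
    next
      case False
      then obtain y where y: "y \<in> X" "\<forall>w\<in>W. w y = 0" "w y \<noteq> 0" using insert by blast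
      \<comment> \<open>The multiple of \<open>w\<close> is chosen such that \<open>g'\<close>
        vanishes at \<open>y\<close>.\<close>
      define g' where "g' = g - cscale (g y / w y) w"
      have lw: "functional_on X w" using insert by blast
      have "functional_on X g'"
        using insert.prems(2) lw unfolding functional_on_def g'_def
        by (auto simp: cscale_apply algebra_simps add_divide_distrib)
      moreover have "g' \<notin> cvec.span W"
      proof
        assume "g' \<in> cvec.span W"
        then have "g' + cscale (g y / w y) w \<in> cvec.span (insert w W)"
          using cvec.span_mono[of W "insert w W"]
          by (auto intro!: cvec.span_add cvec.span_scale intro: cvec.span_base)
        then show False using insert.prems(3) by (simp add: g'_def)
      qed
      ultimately obtain x where x: "x \<in> X" "\<forall>w\<in>W. w x = 0" "g' x \<noteq> 0" using insert by blast
      define a where "a = - w x / w y"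
      define z where "z = x + cscale a y"
      have "cscale a y \<in> X" using X y(1) by (rule cvec.subspace_scale)
      then have z: "h z = h x + a * h y" if "functional_on X h" for h
        using that x(1) y(1) unfolding functional_on_def z_def by simp
      have "z \<in> X" unfolding z_def using X x y by (intro cvec.subspace_add cvec.subspace_scale)
      moreover have "w z = 0" using z[OF lw] y(3) by (simp add: a_def)
      moreover have "\<forall>w\<in>W. w z = 0"
      proof
        fix h assume h: "h \<in> W"
        have "h x = 0" "h y = 0" using x(2) y(2) h by blast+
        moreover have "functional_on X h" using insert.prems(1) h by blast
        ultimately show "h z = 0" using z[of h] by simp
      qed
      moreover have "g z = g' x" using z[OF insert.prems(2)] by (simp add: g'_def cscale_apply a_def)
      ultimately show ?thesis using x(3) by (intro bexI[of _ z]) auto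
    qed
  qed
  then show ?thesis using that by blast
qed

section \<open>Polynomial functions\<close>

lemma poly_fun_sum:
  "finite A \<Longrightarrow> (\<And>i. i \<in> A \<Longrightarrow> f i \<in> poly_fun S) \<Longrightarrow> (\<lambda>x. \<Sum>i\<in>A. f i x) \<in> poly_fun S"
  by (induction A rule: finite_induct) (auto intro: poly_fun.intros)

lemma poly_fun_prod:
  "finite A \<Longrightarrow> (\<And>i. i \<in> A \<Longrightarrow> f i \<in> poly_fun S) \<Longrightarrow> (\<lambda>x. \<Prod>i\<in>A. f i x) \<in> poly_fun S"
  by (induction A rule: finite_induct) (auto intro: poly_fun.intros)

lemma poly_fun_power: "f \<in> poly_fun S \<Longrightarrow> (\<lambda>x. f x ^ n) \<in> poly_fun S"
  by (induction n) (auto intro: poly_fun.intros)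

lemma poly_fun_mono: "p \<in> poly_fun S \<Longrightarrow> S \<subseteq> T \<Longrightarrow> p \<in> poly_fun T"
  by (induction rule: poly_fun.induct) (auto intro: poly_fun.intros)

lemma poly_fun_cong: "p \<in> poly_fun S \<Longrightarrow> (\<And>e. e \<in> S \<Longrightarrow> x e = y e) \<Longrightarrow> p x = p y"
  by (induction rule: poly_fun.induct) auto

lemma poly_fun_comp:
  "p \<in> poly_fun S \<Longrightarrow> (\<And>e. e \<in> S \<Longrightarrow> (\<lambda>x. G x e) \<in> poly_fun T) \<Longrightarrow> (\<lambda>x. p (G x)) \<in> poly_fun T"
  by (induction rule: poly_fun.induct) (auto intro: poly_fun.intros)

text \<open>Restriction to curves reduces questions about polynomials in many variables to
  univariate ones; the curves below are lines, changes of one coordinate and Hadamard products of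
  two lines.\<close>

lemma poly_fun_curve:
  assumes "p \<in> poly_fun S" "\<And>e. e \<in> S \<Longrightarrow> \<exists>q. \<forall>t. z t e = poly q t"
  shows "\<exists>q. \<forall>t. p (z t) = poly q t"
  using assms
proof (induction rule: poly_fun.induct)
  case (const c)
  show ?case by (rule exI[of _ "[:c:]"]) simp
next
  case (add p q)
  then show ?case by (metis poly_add)
next
  case (mult p q)
  then show ?case by (metis poly_mult)
qed auto

lemma poly_fun_line:
  "p \<in> poly_fun S \<Longrightarrow> \<exists>q. \<forall>t. p (x + cscale t y) = poly q t"
proof (erule poly_fun_curve)
  show "\<exists>q. \<forall>t. (x + cscale t y) e = poly q t" for e
    by (rule exI[of _ "[:x e, y e:]"]) (simp add: cscale_apply)
qed

lemma poly_eq_0_if_all: "(\<And>t. poly q t = 0) \<Longrightarrow> q = 0" for q :: "complex poly"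
  using poly_all_0_iff_0 by blast

text \<open>Linear subspaces are irreducible: restrict to the line through two points.\<close>

lemma subspace_poly_fun_no_zero_divisors:
  assumes L: "cvec.subspace L" and pq: "p \<in> poly_fun S" "q \<in> poly_fun S"
    and 0: "\<And>x. x \<in> L \<Longrightarrow> p x * q x = 0"
  shows "(\<forall>x\<in>L. p x = 0) \<or> (\<forall>x\<in>L. q x = 0)"
proof (rule ccontr)
  assume "\<not> ?thesis"
  then obtain x y where xy: "x \<in> L" "p x \<noteq> 0" "y \<in> L" "q y \<noteq> 0" by blast
  obtain P Q where P: "\<And>t. p (x + cscale t (y - x)) = poly P t"
    and Q: "\<And>t. q (x + cscale t (y - x)) = poly Q t"
    using poly_fun_line[OF pq(1)] poly_fun_line[OF pq(2)] by metis
  have "x + cscale t (y - x) \<in> L" for t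
    using xy L by (intro cvec.subspace_add cvec.subspace_scale cvec.subspace_diff)
  then have "poly (P * Q) t = 0" for t using 0 P Q by (metis poly_mult)
  then have "P = 0 \<or> Q = 0" using poly_eq_0_if_all mult_eq_0_iff by blast
  moreover have "poly P 0 \<noteq> 0" "poly Q 1 \<noteq> 0" using P[of 0] Q[of 1] xy by auto
  ultimately show False by auto
qed

section \<open>Monomials and algebraic dependence of polynomials\<close>

definition mono_fun :: "'a set \<Rightarrow> ('a \<Rightarrow> nat) \<Rightarrow> ('a \<Rightarrow> complex) \<Rightarrow> complex" where
  "mono_fun A a z = (\<Prod>i\<in>A. z i ^ a i)"

lemma mono_fun_in: "finite A \<Longrightarrow> mono_fun A a \<in> poly_fun A"
  unfolding mono_fun_def by (intro poly_fun_prod poly_fun_power poly_fun.coord)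

text \<open>Induction on the variables: for fixed values of the other variables the sum is a
  polynomial in the new one, whose coefficients vanish and are sums of the same kind in fewer
  variables.\<close>

lemma monomials_independent:
  assumes "finite A" and "\<And>z. (\<Sum>a\<in>A \<rightarrow>\<^sub>E {..<k}. c a * mono_fun A a z) = 0"
    and "a \<in> A \<rightarrow>\<^sub>E {..<k}"
  shows "c a = 0"
  using assms
proof (induction A arbitrary: c a rule: finite_induct)
  case empty
  then show ?case by (auto simp: mono_fun_def)
next
  case (insert i A)
  define m where "m = (\<lambda>(j, a). (a :: 'a \<Rightarrow> nat)(i := j))"
  have img: "insert i A \<rightarrow>\<^sub>E {..<k} = m ` ({..<k} \<times> (A \<rightarrow>\<^sub>E {..<k}))"
    unfolding m_def by (rule PiE_insert_eq)
  have inj: "inj_on m ({..<k} \<times> (A \<rightarrow>\<^sub>E {..<k}))"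
    unfolding m_def using insert.hyps(2) by (rule inj_combinator)
  have mono: "mono_fun (insert i A) (m (j, a)) (z(i := t)) = t ^ j * mono_fun A a z" for j a z t
  proof -
    have "(\<Prod>l\<in>A. (z(i := t)) l ^ m (j, a) l) = (\<Prod>l\<in>A. z l ^ a l)"
      using insert.hyps(2) by (intro prod.cong) (auto simp: m_def)
    then show ?thesis using insert.hyps by (simp add: mono_fun_def m_def)
  qed
  have "(\<Sum>b\<in>A \<rightarrow>\<^sub>E {..<k}. c (m (j, b)) * mono_fun A b z) = 0" if j: "j < k" for j z
  proof -
    define q where "q = (\<Sum>j<k. monom (\<Sum>b\<in>A \<rightarrow>\<^sub>E {..<k}. c (m (j, b)) * mono_fun A b z) j)"
    have "poly q t = 0" for t
    proof -
      have "poly q t = (\<Sum>j<k. \<Sum>b\<in>A \<rightarrow>\<^sub>E {..<k}. c (m (j, b)) * (t ^ j * mono_fun A b z))"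
        by (simp add: q_def poly_sum poly_monom sum_distrib_left sum_distrib_right mult_ac)
      also have "\<dots> = (\<Sum>jb\<in>{..<k} \<times> (A \<rightarrow>\<^sub>E {..<k}).
          c (m jb) * mono_fun (insert i A) (m jb) (z(i := t)))"
        unfolding sum.cartesian_product by (intro sum.cong) (auto simp: mono)
      also have "\<dots> = (\<Sum>a\<in>insert i A \<rightarrow>\<^sub>E {..<k}. c a * mono_fun (insert i A) a (z(i := t)))"
        unfolding img sum.reindex[OF inj] by simp
      finally show ?thesis using insert.prems(1) by simp
    qed
    then have "coeff q j = 0" using poly_eq_0_if_all[of q] by simp
    then show ?thesis using j by (simp add: q_def coeff_sum if_distrib[of "\<lambda>x. _ * x"] cong: if_cong)
  qed
  then have IH: "c (m (j, b)) = 0" if "j < k" "b \<in> A \<rightarrow>\<^sub>E {..<k}" for j b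
    using insert.IH[of "\<lambda>b. c (m (j, b))" b] that by blast
  from insert.prems(2) obtain j b where "a = m (j, b)" "j < k" "b \<in> A \<rightarrow>\<^sub>E {..<k}"
    unfolding img by auto
  then show ?case using IH by simp
qed

text \<open>For finite \<open>B\<close>, the polynomials of degree at most \<open>N\<close> in each
  variable separately, spanned by at most \<open>(N + 1) ^ card B\<close> monomials.\<close>

definition mono_span :: "'a set \<Rightarrow> nat \<Rightarrow> (('a \<Rightarrow> complex) \<Rightarrow> complex) set" where
  "mono_span B N = cvec.span (mono_fun B ` (B \<rightarrow>\<^sub>E {..N}))"

lemma mono_span_mono: "N \<le> M \<Longrightarrow> mono_span B N \<subseteq> mono_span B M"
  unfolding mono_span_def by (intro cvec.span_mono image_mono PiE_mono) auto

lemma mono_fun_in_mono_span: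
  assumes "\<And>i. i \<in> B \<Longrightarrow> a i \<le> N"
  shows "mono_fun B a \<in> mono_span B N"
proof -
  have "mono_fun B a = mono_fun B (restrict a B)"
    by (auto simp: mono_fun_def fun_eq_iff intro!: prod.cong)
  moreover have "restrict a B \<in> B \<rightarrow>\<^sub>E {..N}" using assms by auto
  ultimately show ?thesis unfolding mono_span_def by (auto intro: cvec.span_base)
qed

lemma mono_span_mult:
  assumes "f \<in> mono_span B N" "g \<in> mono_span B M"
  shows "(\<lambda>x. f x * g x) \<in> mono_span B (N + M)"
proof -
  let ?S = "mono_span B (N + M)"
  have S: "cvec.subspace ?S" unfolding mono_span_def by simp
  have 1: "(\<lambda>x. mono_fun B a x * g x) \<in> ?S" if a: "a \<in> B \<rightarrow>\<^sub>E {..N}" for a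
  proof -
    have "cvec.subspace {g. (\<lambda>x. mono_fun B a x * g x) \<in> ?S}" (is "cvec.subspace ?G")
    proof (rule cvec.subspaceI)
      show "0 \<in> ?G" using cvec.subspace_0[OF S] by (simp add: zero_fun_def)
      show "f + g \<in> ?G" if "f \<in> ?G" "g \<in> ?G" for f g
        using that cvec.subspace_add[OF S, of "\<lambda>x. mono_fun B a x * f x" "\<lambda>x. mono_fun B a x * g x"]
        by (simp add: plus_fun_def distrib_left)
      show "cscale c f \<in> ?G" if "f \<in> ?G" for c f
        using that cvec.subspace_scale[OF S, of "\<lambda>x. mono_fun B a x * f x" c]
        by (simp add: cscale_def mult_ac)
    qed
    moreover have "mono_fun B ` (B \<rightarrow>\<^sub>E {..M}) \<subseteq> ?G"
    proof clarify
      fix b assume b: "b \<in> B \<rightarrow>\<^sub>E {..M}"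
      have "(\<lambda>x. mono_fun B a x * mono_fun B b x) = mono_fun B (\<lambda>i. a i + b i)"
        by (simp add: mono_fun_def fun_eq_iff power_add prod.distrib)
      also have "\<dots> \<in> ?S"
        using a b by (intro mono_fun_in_mono_span add_mono) auto
      finally show "(\<lambda>x. mono_fun B a x * mono_fun B b x) \<in> ?S" .
    qed
    ultimately have "mono_span B M \<subseteq> ?G" unfolding mono_span_def[of B M] by (rule cvec.span_minimal[rotated])
    then show ?thesis using assms(2) by blast
  qed
  have "cvec.subspace {f. (\<lambda>x. f x * g x) \<in> ?S}" (is "cvec.subspace ?F")
  proof (rule cvec.subspaceI)
    show "0 \<in> ?F" using cvec.subspace_0[OF S] by (simp add: zero_fun_def)
    show "f + h \<in> ?F" if "f \<in> ?F" "h \<in> ?F" for f h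
      using that cvec.subspace_add[OF S, of "\<lambda>x. f x * g x" "\<lambda>x. h x * g x"]
      by (simp add: plus_fun_def distrib_right)
    show "cscale c f \<in> ?F" if "f \<in> ?F" for c f
      using that cvec.subspace_scale[OF S, of "\<lambda>x. f x * g x" c]
      by (simp add: cscale_def mult_ac)
  qed
  moreover have "mono_fun B ` (B \<rightarrow>\<^sub>E {..N}) \<subseteq> ?F" using 1 by blast
  ultimately have "mono_span B N \<subseteq> ?F" unfolding mono_span_def[of B N] by (rule cvec.span_minimal[rotated])
  then show ?thesis using assms(1) by blast
qed

lemma mono_span_1: "(\<lambda>x. 1) \<in> mono_span B N"
  using mono_fun_in_mono_span[of B "\<lambda>_. 0" N] by (simp add: mono_fun_def[abs_def])

lemma mono_span_power:
  "f \<in> mono_span B N \<Longrightarrow> (\<lambda>x. f x ^ k) \<in> mono_span B (k * N)"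
  by (induction k) (auto simp: mono_span_1 intro: mono_span_mult)

lemma mono_span_prod:
  "finite A \<Longrightarrow> (\<And>i. i \<in> A \<Longrightarrow> f i \<in> mono_span B N) \<Longrightarrow>
    (\<lambda>x. \<Prod>i\<in>A. f i x) \<in> mono_span B (card A * N)"
  by (induction A rule: finite_induct) (auto simp: mono_span_1 intro: mono_span_mult)

lemma poly_fun_in_mono_span:
  assumes "finite B" "p \<in> poly_fun B"
  shows "\<exists>N. p \<in> mono_span B N"
  using assms(2)
proof (induction rule: poly_fun.induct)
  case (const c)
  have "cscale c (\<lambda>x. 1) \<in> mono_span B 0"
    using mono_span_1 unfolding mono_span_def by (rule cvec.span_scale)
  then show ?case by (auto simp: cscale_def)
next
  case (coord e)
  have "mono_fun B (\<lambda>i. if i = e then 1 else 0) = (\<lambda>x. x e)"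
    using coord assms(1) by (simp add: mono_fun_def fun_eq_iff if_distrib[of "\<lambda>n. _ ^ n"] cong: if_cong)
  moreover have "mono_fun B (\<lambda>i. if i = e then 1 else 0) \<in> mono_span B 1"
    by (rule mono_fun_in_mono_span) simp
  ultimately show ?case by auto
next
  case (add p q)
  then obtain N M where "p \<in> mono_span B N" "q \<in> mono_span B M" by blast
  then have "p \<in> mono_span B (N + M)" "q \<in> mono_span B (N + M)"
    using mono_span_mono[of N "N + M" B] mono_span_mono[of M "N + M" B] by auto
  then have "p + q \<in> mono_span B (N + M)" unfolding mono_span_def by (rule cvec.span_add)
  then show ?case by (auto simp: plus_fun_def)
next
  case (mult p q)
  then show ?case using mono_span_mult by blast
qed

text \<open>Independence in \<open>cvec\<close> concerns sets, whereas a family may repeat a vector;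
  hence the separate case of \<open>f\<close> not injective.\<close>

lemma dependent_family_if_card:
  assumes "finite T" "finite S" "\<And>t. t \<in> T \<Longrightarrow> f t \<in> cvec.span S" "card S < card T"
  obtains c where "\<exists>t\<in>T. c t \<noteq> 0" "(\<Sum>t\<in>T. cscale (c t) (f t)) = 0"
proof (cases "inj_on f T")
  case False
  then obtain s t where st: "s \<in> T" "t \<in> T" "s \<noteq> t" "f s = f t" by (auto simp: inj_on_def)
  define c where "c r = (if r = s then 1 else if r = t then -1 else (0::complex))" for r
  have "(\<Sum>r\<in>T. cscale (c r) (f r)) = (\<Sum>r\<in>{s, t}. cscale (c r) (f r))"
    using st assms(1) by (intro sum.mono_neutral_right) (auto simp: c_def)
  also have "\<dots> = 0" using st by (simp add: c_def cvec.scale_minus_left)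
  finally have "(\<Sum>r\<in>T. cscale (c r) (f r)) = 0" .
  moreover have "c s \<noteq> 0" by (simp add: c_def)
  ultimately show ?thesis using that[of c] st(1) by blast
next
  case True
  have "\<not> cvec.independent (f ` T)"
    using cvec.independent_span_bound[OF assms(2), of "f ` T"] assms card_image[OF True] by auto
  then obtain u where u: "\<exists>v\<in>f ` T. u v \<noteq> 0" "(\<Sum>v\<in>f ` T. cscale (u v) v) = 0"
    using cvec.dependent_finite[of "f ` T"] assms(1) by auto
  then show ?thesis using that[of "u \<circ> f"] True by (auto simp: sum.reindex)
qed

text \<open>Compare the number of monomials in the \<open>G i\<close> with exponents below \<open>k\<close>, which is
  \<open>k ^ card A\<close>, with the dimension \<open>O(k ^ card B)\<close> of a space containing them.\<close>

lemma polynomials_algebraically_dependent: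
  fixes G :: "'i \<Rightarrow> ('j \<Rightarrow> complex) \<Rightarrow> complex"
  assumes A: "finite A" and B: "finite B" and card: "card B < card A"
    and G: "\<And>i. i \<in> A \<Longrightarrow> G i \<in> poly_fun B"
  obtains p where "p \<in> poly_fun A" "\<exists>z. p z \<noteq> 0" "\<And>y. p (\<lambda>i. G i y) = 0"
proof -
  have "\<forall>i\<in>A. \<exists>N. G i \<in> mono_span B N" using G poly_fun_in_mono_span[OF B] by blast
  then obtain N where N: "\<And>i. i \<in> A \<Longrightarrow> G i \<in> mono_span B (N i)" by metis
  define M where "M = Max (insert 0 (N ` A))"
  have M: "G i \<in> mono_span B M" if "i \<in> A" for i
  proof -
    have "N i \<le> M" unfolding M_def using A that by (intro Max_ge) auto
    then show ?thesis using N that mono_span_mono by blast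
  qed
  \<comment> \<open>\<open>k\<close> exceeds the constant factor in the bound
    \<open>k ^ card B * (card A * M + 1) ^ card B\<close> on the number of monomials in
    \<open>B\<close>, so this bound is less than \<open>k ^ Suc (card B)\<close>.\<close>
  define k where "k = Suc ((card A * M + 1) ^ card B)"
  \<comment> \<open>Bounds the degree in each variable of a product of powers
    \<open>G i ^ a i\<close> with exponents below \<open>k\<close>.\<close>
  define D where "D = card A * (k * M)"
  define f where "f a = (\<lambda>y. mono_fun A a (\<lambda>i. G i y))" for a
  have f: "f a \<in> cvec.span (mono_fun B ` (B \<rightarrow>\<^sub>E {..D}))" if a: "a \<in> A \<rightarrow>\<^sub>E {..<k}" for a
  proof -
    have "(\<lambda>y. G i y ^ a i) \<in> mono_span B (k * M)" if "i \<in> A" for i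
    proof -
      have "a i < k" using a that by auto
      then have "a i * M \<le> k * M" by simp
      then show ?thesis using mono_span_power[OF M[OF that], of "a i"] mono_span_mono by blast
    qed
    then have "(\<lambda>y. \<Prod>i\<in>A. G i y ^ a i) \<in> mono_span B D"
      unfolding D_def by (intro mono_span_prod A)
    then show ?thesis by (simp add: f_def mono_fun_def[of A] mono_span_def)
  qed
  have "card (mono_fun B ` (B \<rightarrow>\<^sub>E {..D})) \<le> card (B \<rightarrow>\<^sub>E {..D})"
    using B by (intro card_image_le finite_PiE) auto
  also have "\<dots> = (D + 1) ^ card B" using B by (simp add: card_PiE)
  also have "\<dots> \<le> (k * (card A * M + 1)) ^ card B"
  proof (rule power_mono)
    have "1 \<le> k" by (simp add: k_def)
    then show "D + 1 \<le> k * (card A * M + 1)" by (simp add: D_def distrib_left mult_ac)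
  qed simp
  also have "\<dots> = k ^ card B * (card A * M + 1) ^ card B" by (simp only: power_mult_distrib)
  also have "\<dots> < k ^ card B * k" by (simp add: k_def)
  also have "\<dots> = k ^ Suc (card B)" by simp
  also have "\<dots> \<le> k ^ card A" using card by (intro power_increasing) (auto simp: k_def)
  also have "\<dots> = card (A \<rightarrow>\<^sub>E {..<k})" using A by (simp add: card_PiE)
  finally have lt: "card (mono_fun B ` (B \<rightarrow>\<^sub>E {..D})) < card (A \<rightarrow>\<^sub>E {..<k})" .
  have fin: "finite (A \<rightarrow>\<^sub>E {..<k})" "finite (mono_fun B ` (B \<rightarrow>\<^sub>E {..D}))"
    using A B by (auto intro: finite_PiE)
  obtain c where c: "\<exists>a\<in>A \<rightarrow>\<^sub>E {..<k}. c a \<noteq> 0"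
    "(\<Sum>a\<in>A \<rightarrow>\<^sub>E {..<k}. cscale (c a) (f a)) = 0"
    by (rule dependent_family_if_card[OF fin f lt])
  define p where "p z = (\<Sum>a\<in>A \<rightarrow>\<^sub>E {..<k}. c a * mono_fun A a z)" for z
  show ?thesis
  proof (rule that[of p])
    show "p \<in> poly_fun A"
      unfolding p_def[abs_def]
      by (intro poly_fun_sum poly_fun.mult poly_fun.const mono_fun_in A fin)
    show "\<exists>z. p z \<noteq> 0"
      using monomials_independent[OF A, where k = k and c = c] c(1) unfolding p_def by blast
    show "p (\<lambda>i. G i y) = 0" for y
      using fun_cong[OF c(2), of y] by (simp add: p_def f_def sum_fun_apply cscale_apply)
  qed
qed

section \<open>Dimension and algebraic independence\<close>

text \<open>Division by the variable \<open>z e\<close>, by structural induction; for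
  \<open>e \<notin> S\<close> the part \<open>p0\<close> is free of that variable.\<close>

lemma poly_fun_decomp:
  "p \<in> poly_fun (insert e S) \<Longrightarrow>
    \<exists>p0\<in>poly_fun S. \<exists>p1\<in>poly_fun (insert e S). \<forall>z. p z = p0 z + z e * p1 z"
proof (induction rule: poly_fun.induct)
  case (const c)
  show ?case
    by (intro bexI[of _ "\<lambda>z. c"] bexI[of _ "\<lambda>z. 0"]) (auto intro: poly_fun.const)
next
  case (coord f)
  show ?case
  proof (cases "f = e")
    case True
    then show ?thesis
      by (intro bexI[of _ "\<lambda>z. 0"] bexI[of _ "\<lambda>z. 1"]) (auto intro: poly_fun.const)
  next
    case False
    then show ?thesis using coord
      by (intro bexI[of _ "\<lambda>z. z f"] bexI[of _ "\<lambda>z. 0"]) (auto intro: poly_fun.const poly_fun.coord)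
  qed
next
  case (add p q)
  then obtain p0 p1 q0 q1 where
    "p0 \<in> poly_fun S" "p1 \<in> poly_fun (insert e S)" "\<And>z. p z = p0 z + z e * p1 z"
    "q0 \<in> poly_fun S" "q1 \<in> poly_fun (insert e S)" "\<And>z. q z = q0 z + z e * q1 z" by blast
  then show ?case
    by (intro bexI[of _ "\<lambda>z. p0 z + q0 z"] bexI[of _ "\<lambda>z. p1 z + q1 z"])
      (auto intro: poly_fun.add simp: algebra_simps)
next
  case (mult p q)
  then obtain p0 p1 q0 q1 where
    *: "p0 \<in> poly_fun S" "p1 \<in> poly_fun (insert e S)" "\<And>z. p z = p0 z + z e * p1 z"
    "q0 \<in> poly_fun S" "q1 \<in> poly_fun (insert e S)" "\<And>z. q z = q0 z + z e * q1 z" by blast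
  have "p0 \<in> poly_fun (insert e S)" "q0 \<in> poly_fun (insert e S)"
    using * poly_fun_mono by blast+
  then have "(\<lambda>z. p0 z * q1 z + p1 z * q z) \<in> poly_fun (insert e S)"
    using * mult by (intro poly_fun.add poly_fun.mult)
  then show ?case using *
    by (intro bexI[of _ "\<lambda>z. p0 z * q0 z"] bexI[of _ "\<lambda>z. p0 z * q1 z + p1 z * q z"])
      (auto intro: poly_fun.mult simp: algebra_simps)
qed

section \<open>Chains of irreducible closed sets and Krull dimension\<close>

lemma closedin_zero_locus: "P \<subseteq> poly_fun S \<Longrightarrow> closedin (zariski S) (zero_locus S P)"
  unfolding closedin_zariski by blast

lemma irreducible_in_poly_fun:
  assumes Z: "irreducible_in (zariski S) Z" and pq: "p \<in> poly_fun S" "q \<in> poly_fun S"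
    and 0: "\<And>x. x \<in> Z \<Longrightarrow> p x * q x = 0"
  shows "(\<forall>x\<in>Z. p x = 0) \<or> (\<forall>x\<in>Z. q x = 0)"
proof -
  have "Z \<subseteq> cspace S" using Z unfolding irreducible_in_def by simp
  then have "Z \<subseteq> zero_locus S {p} \<union> zero_locus S {q}" using 0 unfolding zero_locus_def by auto
  then have "Z \<subseteq> zero_locus S {p} \<or> Z \<subseteq> zero_locus S {q}"
    using Z pq closedin_zero_locus[of "{p}"] closedin_zero_locus[of "{q}"]
    unfolding irreducible_in_def by blast
  then show ?thesis unfolding zero_locus_def by auto
qed

lemma subspace_irreducible_in:
  assumes L: "cvec.subspace L" "L \<subseteq> cspace S"
  shows "irreducible_in (zariski S) L"
  unfolding irreducible_in_def
proof (intro conjI allI impI)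
  show "L \<noteq> {}" using cvec.subspace_0[OF L(1)] by blast
  show "L \<subseteq> topspace (zariski S)" using L(2) by simp
next
  fix A B assume "closedin (zariski S) A \<and> closedin (zariski S) B \<and> L \<subseteq> A \<union> B"
  then obtain P Q where P: "P \<subseteq> poly_fun S" "A = zero_locus S P"
    and Q: "Q \<subseteq> poly_fun S" "B = zero_locus S Q" and LAB: "L \<subseteq> A \<union> B"
    unfolding closedin_zariski by blast
  show "L \<subseteq> A \<or> L \<subseteq> B"
  proof (rule ccontr)
    assume "\<not> (L \<subseteq> A \<or> L \<subseteq> B)"
    then obtain x y where "x \<in> L" "x \<notin> A" "y \<in> L" "y \<notin> B" by blast
    then obtain p q where pq: "p \<in> P" "q \<in> Q" "p x \<noteq> 0" "q y \<noteq> 0"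
      using L(2) unfolding P Q zero_locus_def by blast
    have "p x * q x = 0" if "x \<in> L" for x
      using LAB that pq unfolding P Q zero_locus_def by auto
    then have "(\<forall>x\<in>L. p x = 0) \<or> (\<forall>x\<in>L. q x = 0)"
      using subspace_poly_fun_no_zero_divisors[OF L(1)] pq P(1) Q(1) by blast
    then show False using pq \<open>x \<in> L\<close> \<open>y \<in> L\<close> by blast
  qed
qed

lemma cspace_subset_eq_zero_locus:
  assumes "T \<subseteq> S"
  shows "cspace T = zero_locus S ((\<lambda>e x. x e) ` (S - T))"
proof -
  have "x e = 0" if "x \<in> cspace S" "\<forall>e\<in>S - T. x e = 0" "e \<notin> T" for x :: "'a \<Rightarrow> complex" and e
    using that unfolding cspace_def by (cases "e \<in> S") auto
  moreover have "x \<in> cspace S \<and> (\<forall>e\<in>S - T. x e = 0)" if "x \<in> cspace T" for x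
    using that assms unfolding cspace_def by auto
  ultimately show ?thesis unfolding zero_locus_def cspace_def[of T] ball_simps by blast
qed

lemma cspace_mono: "T \<subseteq> S \<Longrightarrow> cspace T \<subseteq> cspace S"
  unfolding cspace_def by blast

lemma subspace_cspace: "cvec.subspace (cspace S)"
  by (rule cvec.subspaceI) (auto simp: cspace_def cscale_apply)

text \<open>Polynomials \<open>g i\<close> vanishing on \<open>Z i\<close> but not on \<open>Z (Suc i)\<close> are algebraically independent,
  so there are at most \<open>card I\<close> of them.\<close>

lemma zariski_chain_alg_independent:
  fixes Z :: "nat \<Rightarrow> ('e \<Rightarrow> complex) set"
  assumes irr: "\<And>i. i \<le> n \<Longrightarrow> irreducible_in (zariski S) (Z i)"
    and g: "\<And>i. i < n \<Longrightarrow> g i \<in> poly_fun S"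
    and g0: "\<And>i x. i < n \<Longrightarrow> x \<in> Z i \<Longrightarrow> g i x = 0"
    and g1: "\<And>i. i < n \<Longrightarrow> \<exists>x\<in>Z (Suc i). g i x \<noteq> 0"
    and mono: "\<And>i. i < n \<Longrightarrow> Z i \<subseteq> Z (Suc i)"
  shows "m \<le> n \<Longrightarrow> p \<in> poly_fun {..<m} \<Longrightarrow> (\<And>x. x \<in> Z m \<Longrightarrow> p (\<lambda>i. g i x) = 0) \<Longrightarrow> p z = 0"
proof (induction m arbitrary: p z)
  case 0
  then obtain x where "x \<in> Z 0" using irr[of 0] unfolding irreducible_in_def by blast
  then have "p (\<lambda>i. g i x) = 0" using 0 by blast
  then show ?case using poly_fun_cong[OF 0(2), of z "\<lambda>i. g i x"] by simp
next
  case (Suc m)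
  have m: "m < n" using Suc.prems(1) by simp
  \<comment> \<open>Inner induction on the degree of \<open>p\<close> in the variable
    \<open>m\<close>, the other variables being fixed at \<open>z\<close>.\<close>
  have line: "P = 0" if "p \<in> poly_fun {..<Suc m}" "\<And>x. x \<in> Z (Suc m) \<Longrightarrow> p (\<lambda>i. g i x) = 0"
    "\<And>t. p (z(m := t)) = poly P t" for p P
    using that
  proof (induction "degree P" arbitrary: p P rule: less_induct)
    case less
    have "{..<Suc m} = insert m {..<m}" by auto
    then obtain p0 p1 where p0: "p0 \<in> poly_fun {..<m}" and p1: "p1 \<in> poly_fun {..<Suc m}"
      and p: "\<And>z. p z = p0 z + z m * p1 z"
      using poly_fun_decomp[of p m "{..<m}"] less.prems(1) by auto
    \<comment> \<open>\<open>g m\<close> vanishes on \<open>Z m\<close>, so there \<open>p\<close>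
      reduces to \<open>p0\<close>, which involves the earlier variables only; the outer induction
      applies to it.\<close>
    have "p0 (\<lambda>i. g i x) = 0" if x: "x \<in> Z m" for x
      using less.prems(2)[of x] mono[OF m] x p[of "\<lambda>i. g i x"] g0[OF m x] by auto
    then have p0_0: "p0 z = 0" for z using Suc.IH p0 m by simp
    \<comment> \<open>On \<open>Z (Suc m)\<close> the product of \<open>g m\<close> and
      \<open>p1\<close> remains; as \<open>g m\<close> is nonzero somewhere, irreducibility forces
      \<open>p1\<close> to vanish.\<close>
    have "g m x * p1 (\<lambda>i. g i x) = 0" if x: "x \<in> Z (Suc m)" for x
      using less.prems(2)[OF x] p p0_0 by simp
    moreover have "(\<lambda>x. p1 (\<lambda>i. g i x)) \<in> poly_fun S"
      by (rule poly_fun_comp[OF p1]) (use g m in auto)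
    ultimately have p1_0: "p1 (\<lambda>i. g i x) = 0" if "x \<in> Z (Suc m)" for x
      using irreducible_in_poly_fun[OF irr[OF Suc.prems(1)] g[OF m]] g1[OF m] that by blast
    obtain P1 where P1: "\<And>t. p1 (z(m := t)) = poly P1 t"
    proof -
      have "\<exists>q. \<forall>t. p1 (z(m := t)) = poly q t"
      proof (rule poly_fun_curve[OF p1])
        show "\<exists>q. \<forall>t. (z(m := t)) i = poly q t" for i
          by (rule exI[of _ "if i = m then [:0, 1:] else [:z i:]"]) simp
      qed
      then show ?thesis using that by blast
    qed
    have "poly (P - pCons 0 P1) t = 0" for t
      using less.prems(3)[of t] p[of "z(m := t)"] P1[of t] p0_0 by simp
    then have P: "P = pCons 0 P1" using poly_eq_0_if_all[of "P - pCons 0 P1"] by simp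
    show ?case
    proof (rule ccontr)
      assume "P \<noteq> 0"
      then have "degree P1 < degree P" "P1 \<noteq> 0" using P by auto
      then show False using less.hyps[OF _ p1 p1_0 P1] by blast
    qed
  qed
  have "\<exists>q. \<forall>t. p (z(m := t)) = poly q t"
  proof (rule poly_fun_curve[OF Suc.prems(2)])
    show "\<exists>q. \<forall>t. (z(m := t)) i = poly q t" for i
      by (rule exI[of _ "if i = m then [:0, 1:] else [:z i:]"]) simp
  qed
  then obtain P where P: "\<And>t. p (z(m := t)) = poly P t" by blast
  have "P = 0" by (rule line[OF Suc.prems(2,3) P])
  then show ?case using P[of "z m"] by simp
qed

text \<open>A longer chain would give more than \<open>card S\<close> algebraically independent
  polynomials in \<open>card S\<close> variables.\<close>

lemma zariski_chain_le_card:
  fixes Z :: "nat \<Rightarrow> ('e \<Rightarrow> complex) set"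
  assumes S: "finite S"
    and Z: "\<And>i. i \<le> n \<Longrightarrow> closedin (zariski S) (Z i)" "\<And>i. i \<le> n \<Longrightarrow> irreducible_in (zariski S) (Z i)"
    and strict: "\<And>i. i < n \<Longrightarrow> Z i \<subset> Z (Suc i)"
  shows "n \<le> card S"
proof (rule ccontr)
  assume "\<not> n \<le> card S"
  have "\<exists>g\<in>poly_fun S. (\<forall>x\<in>Z i. g x = 0) \<and> (\<exists>x\<in>Z (Suc i). g x \<noteq> 0)" if i: "i < n" for i
  proof -
    obtain P where P: "P \<subseteq> poly_fun S" "Z i = zero_locus S P"
      using Z(1)[of i] i unfolding closedin_zariski by auto
    obtain x where x: "x \<in> Z (Suc i)" "x \<notin> Z i" using strict[OF i] by blast
    have "x \<in> cspace S" using x Z(2)[of "Suc i"] i unfolding irreducible_in_def by auto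
    then obtain p where "p \<in> P" "p x \<noteq> 0" using x(2) unfolding P(2) zero_locus_def by blast
    then show ?thesis using x(1) P by (intro bexI[of _ p]) (auto simp: zero_locus_def)
  qed
  then obtain g where g: "\<And>i. i < n \<Longrightarrow> g i \<in> poly_fun S"
    "\<And>i x. i < n \<Longrightarrow> x \<in> Z i \<Longrightarrow> g i x = 0" "\<And>i. i < n \<Longrightarrow> \<exists>x\<in>Z (Suc i). g i x \<noteq> 0"
    by metis
  obtain p where p: "p \<in> poly_fun {..<n}" "\<exists>z. p z \<noteq> 0" "\<And>y. p (\<lambda>i. g i y) = 0"
    by (rule polynomials_algebraically_dependent[of "{..<n}" S g])
      (use S g(1) \<open>\<not> n \<le> card S\<close> in auto)
  have mono: "Z i \<subseteq> Z (Suc i)" if "i < n" for i using strict[OF that] by blast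
  have "p z = 0" for z
    by (rule zariski_chain_alg_independent[of n S Z g n p z]) (use Z(2) g p mono in auto)
  then show False using p(2) by blast
qed

lemma zariski_closure_of:
  assumes "A \<subseteq> cspace S"
  shows "zariski S closure_of A = zero_locus S {p \<in> poly_fun S. \<forall>x\<in>A. p x = 0}"
proof
  show "zariski S closure_of A \<subseteq> zero_locus S {p \<in> poly_fun S. \<forall>x\<in>A. p x = 0}"
  proof (rule closure_of_minimal)
    show "A \<subseteq> zero_locus S {p \<in> poly_fun S. \<forall>x\<in>A. p x = 0}"
      using assms by (auto simp: zero_locus_def)
  qed (rule closedin_zero_locus, blast)
next
  obtain P where P: "P \<subseteq> poly_fun S" "zariski S closure_of A = zero_locus S P"
    using closedin_closure_of[of "zariski S" A] unfolding closedin_zariski by blast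
  have "A \<subseteq> zero_locus S P" using closure_of_subset[of A "zariski S"] assms P(2) by simp
  then show "zero_locus S {p \<in> poly_fun S. \<forall>x\<in>A. p x = 0} \<subseteq> zariski S closure_of A"
    unfolding P(2) using P(1) unfolding zero_locus_def by blast
qed

lemma krull_dim_ge_card_cspace:
  assumes "finite S"
  shows "enat (card S) \<le> krull_dim (zariski S)"
proof -
  obtain f where f: "bij_betw f {0..<card S} S" using ex_bij_betw_nat_finite[OF assms] by blast
  \<comment> \<open>The complete flag of coordinate subspaces along an enumeration of
    \<open>S\<close>.\<close>
  define Z where "Z i = cspace (f ` {..<i})" for i
  have fS: "f i \<in> S" if "i < card S" for i using f that by (auto simp: bij_betw_def)
  have sub: "f ` {..<i} \<subseteq> S" if "i \<le> card S" for i using fS that by auto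
  have "closedin (zariski S) (Z i)" if "i \<le> card S" for i
  proof -
    have "Z i = zero_locus S ((\<lambda>e x. x e) ` (S - f ` {..<i}))"
      unfolding Z_def by (rule cspace_subset_eq_zero_locus[OF sub[OF that]])
    moreover have "(\<lambda>e x. x e) ` (S - f ` {..<i}) \<subseteq> poly_fun S" by (auto intro: poly_fun.coord)
    ultimately show ?thesis using closedin_zero_locus by metis
  qed
  moreover have "irreducible_in (zariski S) (Z i)" if "i \<le> card S" for i
    unfolding Z_def using sub[OF that]
    by (intro subspace_irreducible_in subspace_cspace) (rule cspace_mono)
  moreover have "Z i \<subset> Z (Suc i)" if i: "i < card S" for i
  proof -
    have "f j \<noteq> f i" if "j < i" for j
      using bij_betw_imp_inj_on[OF f] i that by (auto simp: inj_on_eq_iff)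
    then have "f i \<notin> f ` {..<i}" by force
    then have "(\<lambda>e. if e = f i then 1 else 0) \<in> Z (Suc i) - Z i" by (auto simp: Z_def cspace_def)
    moreover have "Z i \<subseteq> Z (Suc i)" unfolding Z_def by (intro cspace_mono image_mono) auto
    ultimately show ?thesis by blast
  qed
  ultimately show ?thesis unfolding krull_dim_def by (intro Sup_upper) blast
qed

text \<open>Full dimension means density: a chain in a proper closed subset of
  \<open>cspace S\<close> can be extended at the top by the irreducible space
  \<open>cspace S\<close>.\<close>

lemma zariski_dim_eq_card_iff:
  assumes S: "finite S" and A: "A \<subseteq> cspace S" "A \<noteq> {}"
  shows "zariski_dim S A = enat (card S) \<longleftrightarrow>
    (\<forall>p\<in>poly_fun S. (\<forall>x\<in>A. p x = 0) \<longrightarrow> (\<forall>x\<in>cspace S. p x = 0))" (is "_ \<longleftrightarrow> ?dense")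
proof
  assume ?dense
  then have "zariski S closure_of A = cspace S"
    unfolding zariski_closure_of[OF A(1)] by (auto simp: zero_locus_def)
  then have "zariski_dim S A = krull_dim (zariski S)"
    unfolding zariski_dim_def using subtopology_topspace[of "zariski S"] by simp
  also have "krull_dim (zariski S) = enat (card S)"
  proof (rule antisym)
    show "krull_dim (zariski S) \<le> enat (card S)"
      unfolding krull_dim_def
    proof (rule Sup_least)
      fix d assume "d \<in> {enat n |n. \<exists>Z. (\<forall>i\<le>n. closedin (zariski S) (Z i) \<and>
        irreducible_in (zariski S) (Z i)) \<and> (\<forall>i<n. Z i \<subset> Z (Suc i))}"
      then obtain n Z where "d = enat n" "\<forall>i\<le>n. closedin (zariski S) (Z i) \<and>
        irreducible_in (zariski S) (Z i)" "\<forall>i<n. Z i \<subset> Z (Suc i)" by blast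
      then show "d \<le> enat (card S)" using zariski_chain_le_card[OF S, of n Z] by simp
    qed
  qed (rule krull_dim_ge_card_cspace[OF S])
  finally show "zariski_dim S A = enat (card S)" .
next
  assume dim: "zariski_dim S A = enat (card S)"
  show ?dense
  proof (rule ccontr)
    define C where "C = zariski S closure_of A"
    assume nd: "\<not> ?dense"
    then have ne: "C \<noteq> cspace S"
      unfolding C_def zariski_closure_of[OF A(1)] zero_locus_def by blast
    have C: "closedin (zariski S) C" "C \<subseteq> cspace S"
      unfolding C_def using closure_of_subset_topspace[of "zariski S" A] by auto
    \<comment> \<open>For \<open>S = {}\<close> the space is a single point and the nonempty set
      \<open>A\<close> is all of it. Positivity makes \<open>card S - 1\<close> a true
      predecessor.\<close>
    have "card S > 0"
    proof (rule ccontr)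
      assume "\<not> card S > 0"
      then have "S = {}" using S by simp
      then have "cspace S = {\<lambda>_. 0}" by (auto simp: cspace_def)
      then have "A = cspace S" using A by auto
      then show False using nd by blast
    qed
    have "n \<le> card S - 1"
      if Z: "\<forall>i\<le>n. closedin (subtopology (zariski S) C) (Z i) \<and>
          irreducible_in (subtopology (zariski S) C) (Z i)" "\<forall>i<n. Z i \<subset> Z (Suc i)" for n Z
    proof -
      have ZC: "closedin (zariski S) (Z i)" "Z i \<subseteq> C" if "i \<le> n" for i
        using Z(1) that closedin_closed_subtopology[OF C(1)] by auto
      have irr: "irreducible_in (zariski S) (Z i)" if i: "i \<le> n" for i
        unfolding irreducible_in_def
      proof (intro conjI allI impI)
        have Zi: "irreducible_in (subtopology (zariski S) C) (Z i)" using Z i by blast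
        then show "Z i \<noteq> {}" "Z i \<subseteq> topspace (zariski S)" unfolding irreducible_in_def by auto
        fix A B assume AB: "closedin (zariski S) A \<and> closedin (zariski S) B \<and> Z i \<subseteq> A \<union> B"
        then have "closedin (subtopology (zariski S) C) (A \<inter> C)"
          "closedin (subtopology (zariski S) C) (B \<inter> C)"
          by (auto simp: closedin_subtopology)
        moreover have "Z i \<subseteq> (A \<inter> C) \<union> (B \<inter> C)" using AB ZC(2)[OF i] by blast
        ultimately have "Z i \<subseteq> A \<inter> C \<or> Z i \<subseteq> B \<inter> C"
          using Zi unfolding irreducible_in_def by blast
        then show "Z i \<subseteq> A \<or> Z i \<subseteq> B" by blast
      qed
      define Z' where "Z' i = (if i \<le> n then Z i else cspace S)" for i
      have "Suc n \<le> card S"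
      proof (rule zariski_chain_le_card[OF S])
        show "closedin (zariski S) (Z' i)" for i
          using ZC closedin_topspace[of "zariski S"] by (simp add: Z'_def)
        show "irreducible_in (zariski S) (Z' i)" for i
          using irr subspace_irreducible_in[OF subspace_cspace, of S S] by (simp add: Z'_def)
        show "Z' i \<subset> Z' (Suc i)" if "i < Suc n" for i
          using that Z(2) ZC(2)[of i] C(2) ne by (cases "i = n") (auto simp: Z'_def)
      qed
      then show ?thesis by simp
    qed
    then have "zariski_dim S A \<le> enat (card S - 1)"
      unfolding zariski_dim_def krull_dim_def C_def[symmetric]
      by (intro Sup_least) (elim CollectE exE conjE, simp)
    then show False using dim \<open>card S > 0\<close> by simp
  qed
qed

section \<open>Algebraic and linear independence of coordinates\<close>

definition alg_indep :: "('e \<Rightarrow> complex) set \<Rightarrow> 'e set \<Rightarrow> bool" where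
  "alg_indep W I \<longleftrightarrow> (\<forall>p\<in>poly_fun I. (\<forall>x\<in>W. p x = 0) \<longrightarrow> (\<forall>z. p z = 0))"

text \<open>A polynomial in the coordinates of \<open>I\<close> takes the same value at
  \<open>x\<close> and at \<open>coord_proj I x\<close>. Hence density of the projection means that
  no nontrivial relation holds on \<open>W\<close>, and \<open>alg_indep\<close> may let
  \<open>z\<close> range over all functions.\<close>

lemma indep_sets_algebraic_matroid:
  assumes "W \<noteq> {}"
  shows "indep_sets (algebraic_matroid E W) = {I. I \<subseteq> E \<and> finite I \<and> alg_indep W I}"
proof -
  have "zariski_dim I (coord_proj I ` W) = enat (card I) \<longleftrightarrow> alg_indep W I" if I: "finite I" for I
  proof -
    have proj: "p (coord_proj I x) = p x" if "p \<in> poly_fun I" for p x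
      by (rule poly_fun_cong[OF that]) (simp add: coord_proj_def)
    have in_cspace: "coord_proj I x \<in> cspace I" for x by (simp add: coord_proj_def cspace_def)
    have "zariski_dim I (coord_proj I ` W) = enat (card I) \<longleftrightarrow>
      (\<forall>p\<in>poly_fun I. (\<forall>x\<in>coord_proj I ` W. p x = 0) \<longrightarrow> (\<forall>x\<in>cspace I. p x = 0))"
      by (rule zariski_dim_eq_card_iff[OF I]) (use assms in_cspace in auto)
    also have "\<dots> \<longleftrightarrow> (\<forall>p\<in>poly_fun I. (\<forall>x\<in>W. p x = 0) \<longrightarrow> (\<forall>x\<in>cspace I. p x = 0))"
      by (simp add: proj)
    also have "\<dots> \<longleftrightarrow> alg_indep W I"
    proof -
      have "(\<forall>x\<in>cspace I. p x = 0) \<longleftrightarrow> (\<forall>z. p z = 0)" if "p \<in> poly_fun I" for p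
        using in_cspace proj[OF that] by metis
      then show ?thesis unfolding alg_indep_def by blast
    qed
    finally show ?thesis .
  qed
  then show ?thesis unfolding algebraic_matroid_def indep_sets_def by auto
qed

text \<open>Passing to the closure adds no point where a vanishing polynomial is nonzero, so the set
  of all Hadamard products can stand in for the variety.\<close>

lemma alg_indep_zariski_closure:
  assumes "I \<subseteq> E" "H \<subseteq> cspace E"
  shows "alg_indep (zariski E closure_of H) I \<longleftrightarrow> alg_indep H I"
proof -
  have "(\<forall>x\<in>zariski E closure_of H. p x = 0) \<longleftrightarrow> (\<forall>x\<in>H. p x = 0)" if "p \<in> poly_fun I" for p
    using closure_of_subset[of H "zariski E"] assms poly_fun_mono[OF that assms(1)]
    unfolding zariski_closure_of[OF assms(2)] by (auto simp: zero_locus_def)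
  then show ?thesis unfolding alg_indep_def by blast
qed

lemma alg_indep_subset: "alg_indep W I \<Longrightarrow> J \<subseteq> I \<Longrightarrow> alg_indep W J"
  unfolding alg_indep_def using poly_fun_mono by blast

text \<open>Linear independence, as a family, of the coordinate functionals on
  \<open>X\<close>.\<close>

definition coord_indep :: "('e \<Rightarrow> complex) set \<Rightarrow> 'e set \<Rightarrow> bool" where
  "coord_indep X I \<longleftrightarrow> (\<forall>c. (\<forall>x\<in>X. (\<Sum>e\<in>I. c e * x e) = 0) \<longrightarrow> (\<forall>e\<in>I. c e = 0))"

definition coord_fun :: "('e \<Rightarrow> complex) set \<Rightarrow> 'e \<Rightarrow> ('e \<Rightarrow> complex) \<Rightarrow> complex" where
  "coord_fun X e x = (if x \<in> X then x e else 0)"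

lemma functional_on_coord_fun: "cvec.subspace X \<Longrightarrow> functional_on X (coord_fun X e)"
  unfolding functional_on_def coord_fun_def
  by (simp add: cvec.subspace_add cvec.subspace_scale cscale_apply)

lemma functional_on_add_cscale:
  "functional_on X f \<Longrightarrow> functional_on X g \<Longrightarrow> functional_on X (f + cscale c g)"
  unfolding functional_on_def by (auto simp: cscale_apply algebra_simps)

lemma span_image_obtain:
  assumes "finite J" "g \<in> cvec.span (w ` J)"
  obtains a where "g = (\<Sum>f\<in>J. cscale (a f) (w f))"
proof -
  let ?S = "{g. \<exists>a. g = (\<Sum>f\<in>J. cscale (a f) (w f))}"
  have "cvec.subspace ?S"
  proof (rule cvec.subspaceI)
    show "0 \<in> ?S" by (auto intro!: exI[of _ "\<lambda>_. 0"])
    show "x + y \<in> ?S" if xy: "x \<in> ?S" "y \<in> ?S" for x y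
    proof -
      obtain a b where "x = (\<Sum>f\<in>J. cscale (a f) (w f))" "y = (\<Sum>f\<in>J. cscale (b f) (w f))"
        using xy by blast
      then have "x + y = (\<Sum>f\<in>J. cscale (a f + b f) (w f))"
        by (simp add: cvec.scale_left_distrib sum.distrib)
      then show ?thesis unfolding mem_Collect_eq by (intro exI[of _ "\<lambda>f. a f + b f"])
    qed
    show "cscale c x \<in> ?S" if x: "x \<in> ?S" for c x
    proof -
      obtain a where "x = (\<Sum>f\<in>J. cscale (a f) (w f))" using x by blast
      then have "cscale c x = (\<Sum>f\<in>J. cscale (c * a f) (w f))"
        by (simp add: cvec.scale_sum_right)
      then show ?thesis unfolding mem_Collect_eq by (intro exI[of _ "\<lambda>f. c * a f"])
    qed
  qed
  moreover have "w ` J \<subseteq> ?S"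
  proof clarify
    fix f assume "f \<in> J"
    then have "w f = (\<Sum>h\<in>J. cscale (if h = f then 1 else 0) (w h))"
      using assms(1) by (simp add: if_distrib[of "\<lambda>a. cscale a _"] cong: if_cong)
    then show "\<exists>a. w f = (\<Sum>h\<in>J. cscale (a h) (w h))"
      by (intro exI[of _ "\<lambda>h. if h = f then 1 else 0"])
  qed
  ultimately have "cvec.span (w ` J) \<subseteq> ?S" by (rule cvec.span_minimal[rotated])
  then show ?thesis using assms(2) that by blast
qed

lemma coord_fun_notin_span:
  assumes I: "finite I" "coord_indep X I" "e \<in> I"
  shows "coord_fun X e \<notin> cvec.span (coord_fun X ` (I - {e}))"
proof
  assume "coord_fun X e \<in> cvec.span (coord_fun X ` (I - {e}))"
  then obtain a where a: "coord_fun X e = (\<Sum>f\<in>I - {e}. cscale (a f) (coord_fun X f))"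
    using span_image_obtain[of "I - {e}"] I(1) by blast
  define c where "c f = (if f = e then -1 else a f)" for f
  have "(\<Sum>f\<in>I. c f * x f) = 0" if x: "x \<in> X" for x
  proof -
    have "x e = (\<Sum>f\<in>I - {e}. a f * x f)"
      using fun_cong[OF a, of x] x by (simp add: coord_fun_def sum_fun_apply cscale_apply)
    also have "\<dots> = (\<Sum>f\<in>I - {e}. c f * x f)" by (intro sum.cong) (auto simp: c_def)
    finally show ?thesis by (simp add: sum.remove[OF I(1,3)] c_def)
  qed
  then have "c e = 0" using I(2,3) unfolding coord_indep_def by blast
  then show False by (simp add: c_def)
qed

text \<open>Separation provides vectors dual to the independent functionals; the required point is
  their combination with coefficients \<open>z e\<close>.\<close>

lemma coord_indep_interpolate:
  assumes X: "cvec.subspace X" and I: "finite I" "coord_indep X I"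
  obtains x where "x \<in> X" "\<And>e. e \<in> I \<Longrightarrow> x e = z e"
proof -
  have "\<exists>x\<in>X. (\<forall>f\<in>I - {e}. x f = 0) \<and> x e = 1" if e: "e \<in> I" for e
  proof -
    obtain x where x: "x \<in> X" "\<forall>w\<in>coord_fun X ` (I - {e}). w x = 0" "coord_fun X e x \<noteq> 0"
      by (rule functional_separation[OF X _ _ functional_on_coord_fun[OF X]
            coord_fun_notin_span[OF I e]]) (use I functional_on_coord_fun[OF X] in auto)
    have "cscale (inverse (x e)) x \<in> X" using X x(1) by (rule cvec.subspace_scale)
    moreover have "x f = 0" if "f \<in> I - {e}" for f
      using bspec[OF x(2), of "coord_fun X f"] that x(1) by (auto simp: coord_fun_def)
    ultimately show ?thesis using x(1,3)
      by (intro bexI[of _ "cscale (inverse (x e)) x"]) (auto simp: coord_fun_def cscale_apply)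
  qed
  then obtain b where b: "\<And>e. e \<in> I \<Longrightarrow> b e \<in> X" "\<And>e f. e \<in> I \<Longrightarrow> f \<in> I - {e} \<Longrightarrow> b e f = 0"
    "\<And>e. e \<in> I \<Longrightarrow> b e e = 1" by metis
  show ?thesis
  proof (rule that[of "\<Sum>e\<in>I. cscale (z e) (b e)"])
    show "(\<Sum>e\<in>I. cscale (z e) (b e)) \<in> X"
      using X b(1) by (intro cvec.subspace_sum cvec.subspace_scale)
    show "(\<Sum>e\<in>I. cscale (z e) (b e)) f = z f" if f: "f \<in> I" for f
    proof -
      have "(\<Sum>e\<in>I. cscale (z e) (b e)) f = (\<Sum>e\<in>I. if e = f then z f else 0)"
        unfolding sum_fun_apply by (intro sum.cong) (use b f in \<open>auto simp: cscale_apply\<close>)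
      then show ?thesis using I(1) f by simp
    qed
  qed
qed

text \<open>A linear relation is a polynomial relation. Conversely, linear independence makes the
  projection of \<open>X\<close> to the coordinates in \<open>I\<close> surjective, so a polynomial
  vanishing on \<open>X\<close> vanishes everywhere.\<close>

lemma alg_indep_subspace_iff:
  assumes X: "cvec.subspace X" and I: "finite I"
  shows "alg_indep X I \<longleftrightarrow> coord_indep X I"
proof
  assume alg: "alg_indep X I"
  show "coord_indep X I"
    unfolding coord_indep_def
  proof (intro allI impI ballI)
    fix c e assume c: "\<forall>x\<in>X. (\<Sum>e\<in>I. c e * x e) = 0" and e: "e \<in> I"
    have "(\<lambda>x. \<Sum>e\<in>I. c e * x e) \<in> poly_fun I"
      by (intro poly_fun_sum poly_fun.mult poly_fun.const poly_fun.coord I)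
    from alg[unfolded alg_indep_def, rule_format, OF this] c
    have "\<forall>z. (\<Sum>e\<in>I. c e * z e) = 0" by simp
    from spec[OF this, of "\<lambda>f. if f = e then 1 else 0"]
    have "(\<Sum>f\<in>I. c f * (if f = e then 1 else 0)) = 0" .
    then show "c e = 0" using I e by (simp add: if_distrib[of "\<lambda>x. _ * x"] cong: if_cong)
  qed
next
  assume lin: "coord_indep X I"
  show "alg_indep X I"
    unfolding alg_indep_def
  proof (intro ballI allI impI)
    fix p z assume p: "p \<in> poly_fun I" "\<forall>x\<in>X. p x = 0"
    obtain x where "x \<in> X" "\<And>e. e \<in> I \<Longrightarrow> x e = z e"
      using coord_indep_interpolate[OF X I lin] by blast
    then show "p z = 0" using p poly_fun_cong[OF p(1), of x z] by auto
  qed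
qed

lemma coord_indep_independent:
  assumes "finite I" "coord_indep X I"
  shows "inj_on (coord_fun X) I" "cvec.independent (coord_fun X ` I)"
proof -
  show inj: "inj_on (coord_fun X) I"
  proof (rule inj_onI, rule ccontr)
    fix e f assume ef: "e \<in> I" "f \<in> I" "coord_fun X e = coord_fun X f" "e \<noteq> f"
    then have "coord_fun X e \<in> cvec.span (coord_fun X ` (I - {e}))"
      by (auto intro: cvec.span_base)
    then show False using coord_fun_notin_span[OF assms ef(1)] by simp
  qed
  show "cvec.independent (coord_fun X ` I)"
  proof
    assume "cvec.dependent (coord_fun X ` I)"
    then obtain e where e: "e \<in> I" "coord_fun X e \<in> cvec.span (coord_fun X ` I - {coord_fun X e})"
      unfolding cvec.dependent_def by auto
    moreover have "coord_fun X ` I - {coord_fun X e} \<subseteq> coord_fun X ` (I - {e})" by blast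
    ultimately show False using coord_fun_notin_span[OF assms e(1)] cvec.span_mono by blast
  qed
qed

section \<open>Necessity of the rank condition\<close>

text \<open>For finite \<open>S\<close> the maximum in \<open>rank_fun\<close> is taken over a
  finite set, nonempty because of \<open>{}\<close>; so it is an upper bound that is
  attained.\<close>

lemma coord_indep_rank_fun:
  assumes U: "cvec.subspace U" and S: "finite S" "S \<subseteq> E"
  shows "K \<subseteq> S \<Longrightarrow> coord_indep U K \<Longrightarrow> int (card K) \<le> rank_fun (algebraic_matroid E U) S"
    and "\<exists>K\<subseteq>S. coord_indep U K \<and> int (card K) = rank_fun (algebraic_matroid E U) S"
proof -
  have "U \<noteq> {}" using cvec.subspace_0[OF U] by blast
  have "I \<in> indep_sets (algebraic_matroid E U) \<and> I \<subseteq> S \<longleftrightarrow> I \<subseteq> S \<and> coord_indep U I" for I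
    unfolding indep_sets_algebraic_matroid[OF \<open>U \<noteq> {}\<close>]
    using S finite_subset[of I S] alg_indep_subspace_iff[OF U, of I] by blast
  then have rank: "rank_fun (algebraic_matroid E U) S = int (Max (card ` {I. I \<subseteq> S \<and> coord_indep U I}))"
    unfolding rank_fun_def by (simp add: image_Collect)
  have fin: "finite (card ` {I. I \<subseteq> S \<and> coord_indep U I})" using S(1) by simp
  show "int (card K) \<le> rank_fun (algebraic_matroid E U) S" if "K \<subseteq> S" "coord_indep U K"
  proof -
    have "card K \<in> card ` {I. I \<subseteq> S \<and> coord_indep U I}" using that by blast
    then show ?thesis unfolding rank using Max_ge[OF fin] by simp
  qed
  have "{} \<in> {I. I \<subseteq> S \<and> coord_indep U I}" by (simp add: coord_indep_def)
  then have "Max (card ` {I. I \<subseteq> S \<and> coord_indep U I}) \<in> card ` {I. I \<subseteq> S \<and> coord_indep U I}"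
    by (intro Max_in fin) blast
  then show "\<exists>K\<subseteq>S. coord_indep U K \<and> int (card K) = rank_fun (algebraic_matroid E U) S"
    unfolding rank by auto
qed

lemma coord_indep_singleton: "x \<in> X \<Longrightarrow> x e \<noteq> 0 \<Longrightarrow> coord_indep X {e}"
  unfolding coord_indep_def by auto

text \<open>\<open>K\<close> is maximal among the coordinate-independent sets between
  \<open>K0\<close> and \<open>J\<close>; a relation on \<open>insert e K\<close> then involves
  \<open>e\<close> and can be solved for \<open>x e\<close>.\<close>

lemma coord_basis_extend:
  assumes J: "finite J" "K0 \<subseteq> J" "coord_indep X K0"
  obtains K where "K0 \<subseteq> K" "K \<subseteq> J" "coord_indep X K"
    "\<forall>e\<in>J. \<exists>a. \<forall>x\<in>X. x e = (\<Sum>k\<in>K. a k * x k)"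
proof -
  let ?F = "{K. K0 \<subseteq> K \<and> K \<subseteq> J \<and> coord_indep X K}"
  have "finite ?F" using J(1) by simp
  moreover have "K0 \<in> ?F" using J by blast
  ultimately have "\<exists>K\<in>?F. \<forall>K'\<in>?F. K \<subseteq> K' \<longrightarrow> K = K'"
    by (intro finite_has_maximal) blast+
  then obtain K where K: "K0 \<subseteq> K" "K \<subseteq> J" "coord_indep X K"
    and max: "\<And>K'. K0 \<subseteq> K' \<Longrightarrow> K' \<subseteq> J \<Longrightarrow> coord_indep X K' \<Longrightarrow> K \<subseteq> K' \<Longrightarrow> K = K'"
    by auto
  have finK: "finite K" using K J(1) finite_subset by blast
  have "\<exists>a. \<forall>x\<in>X. x e = (\<Sum>k\<in>K. a k * x k)" if e: "e \<in> J" for e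
  proof (cases "e \<in> K")
    case True
    then show ?thesis using finK
      by (intro exI[of _ "\<lambda>k. if k = e then 1 else 0"])
        (simp add: if_distrib[of "\<lambda>a. a * _"] cong: if_cong)
  next
    case False
    then have "\<not> coord_indep X (insert e K)" using max[of "insert e K"] K e by blast
    then obtain c where c: "\<forall>x\<in>X. (\<Sum>k\<in>insert e K. c k * x k) = 0" "\<exists>k\<in>insert e K. c k \<noteq> 0"
      unfolding coord_indep_def by blast
    have rel: "c e * x e + (\<Sum>k\<in>K. c k * x k) = 0" if "x \<in> X" for x
      using c(1) that False finK by simp
    have "c e \<noteq> 0"
    proof
      assume ce: "c e = 0"
      then have "\<forall>k\<in>K. c k = 0" using rel K(3) unfolding coord_indep_def by auto
      then show False using c(2) ce by blast
    qed
    have "x e = (\<Sum>k\<in>K. (- c k / c e) * x k)" if "x \<in> X" for x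
    proof -
      have "x e = - (\<Sum>k\<in>K. c k * x k) / c e"
        using rel[OF that] \<open>c e \<noteq> 0\<close> by (simp add: field_simps add_eq_0_iff)
      then show ?thesis by (simp add: sum_divide_distrib sum_negf)
    qed
    then show ?thesis by (intro exI[of _ "\<lambda>k. - c k / c e"]) blast
  qed
  then show ?thesis by (intro that[OF K] ballI)
qed

text \<open>Rescaling to \<open>x e0 = 1\<close> saves one of the \<open>card K + card L\<close> parameters.\<close>

lemma alg_indep_hadamard_card_le:
  assumes U: "cvec.subspace U" and V: "cvec.subspace V" and J: "finite J" "e0 \<in> J"
    and x0: "x0 \<in> U" "x0 e0 \<noteq> 0" and alg: "alg_indep {hadamard x y | x y. x \<in> U \<and> y \<in> V} J"
  obtains K L where "K \<subseteq> J" "coord_indep U K" "L \<subseteq> J" "coord_indep V L"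
    "Suc (card J) \<le> card K + card L"
proof -
  \<comment> \<open>\<open>K\<close> is made to contain \<open>e0\<close>, so that the parameter
    \<open>x e0\<close> can be fixed to \<open>1\<close>.\<close>
  have "{e0} \<subseteq> J" using J(2) by simp
  then obtain K where K: "{e0} \<subseteq> K" "K \<subseteq> J" "coord_indep U K"
    "\<forall>e\<in>J. \<exists>a. \<forall>x\<in>U. x e = (\<Sum>k\<in>K. a k * x k)"
    by (rule coord_basis_extend[OF J(1) _ coord_indep_singleton[OF x0]])
  have "coord_indep V {}" by (simp add: coord_indep_def)
  then obtain L where L: "L \<subseteq> J" "coord_indep V L"
    "\<forall>e\<in>J. \<exists>a. \<forall>x\<in>V. x e = (\<Sum>k\<in>L. a k * x k)"
    by (rule coord_basis_extend[OF J(1) empty_subsetI])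
  obtain a where a: "\<forall>e\<in>J. \<forall>x\<in>U. x e = (\<Sum>k\<in>K. a e k * x k)"
    using bchoice[OF K(4)] by (rule exE)
  obtain b where b: "\<forall>e\<in>J. \<forall>x\<in>V. x e = (\<Sum>k\<in>L. b e k * x k)"
    using bchoice[OF L(3)] by (rule exE)
  have e0K: "e0 \<in> K" using K(1) by simp
  have fin: "finite K" "finite L" using K(2) L(1) J(1) finite_subset by blast+
  \<comment> \<open>The remaining parameters: the coordinates of \<open>x\<close> in
    \<open>K - {e0}\<close> and of \<open>y\<close> in \<open>L\<close>.\<close>
  define B where "B = (K - {e0}) <+> L"
  have cardB: "Suc (card B) = card K + card L"
    unfolding B_def using fin card.remove[OF fin(1) e0K] by (simp add: card_Plus)
  have finB: "finite B" unfolding B_def using fin by simp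
  have "card J \<le> card B"
  proof (rule ccontr)
    assume "\<not> card J \<le> card B"
    then have lt: "card B < card J" by simp
    \<comment> \<open>The product \<open>x e * y e\<close> in terms of the parameters at
      \<open>x e0 = 1\<close>; hence the constant \<open>a e e0\<close>.\<close>
    define G where "G e = (\<lambda>y. (a e e0 + (\<Sum>k\<in>K - {e0}. a e k * y (Inl k))) * (\<Sum>l\<in>L. b e l * y (Inr l)))"
      for e
    have "G e \<in> poly_fun B" for e
      unfolding G_def B_def using fin
      by (intro poly_fun.mult poly_fun.add poly_fun.const poly_fun_sum poly_fun.coord) auto
    then obtain p where p: "p \<in> poly_fun J" "\<exists>z. p z \<noteq> 0" "\<And>y. p (\<lambda>e. G e y) = 0"
      using polynomials_algebraically_dependent[OF J(1) finB lt] by blast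
    \<comment> \<open>The parametrization does not account for \<open>x e0 = 0\<close>; the factor
      \<open>hadamard x y e0\<close> takes care of these pairs.\<close>
    have 0: "p (hadamard x y) * hadamard x y e0 = 0" if xy: "x \<in> U" "y \<in> V" for x y
    proof (cases "x e0 = 0")
      case True
      then show ?thesis by (simp add: hadamard_def)
    next
      case False
      define x' y' where "x' = cscale (inverse (x e0)) x" and "y' = cscale (x e0) y"
      have x'y': "x' \<in> U" "y' \<in> V" using U V xy by (auto simp: x'_def y'_def cvec.subspace_scale)
      have x'1: "x' e0 = 1" using False by (simp add: x'_def cscale_apply)
      have had: "hadamard x y = hadamard x' y'"
        using False by (auto simp: hadamard_def x'_def y'_def cscale_def)
      have "G e (case_sum x' y') = hadamard x y e" if e: "e \<in> J" for e
      proof -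
        have "a e e0 + (\<Sum>k\<in>K - {e0}. a e k * x' k) = x' e"
          using bspec[OF bspec[OF a e] x'y'(1)] x'1 by (simp add: sum.remove[OF fin(1) e0K])
        moreover have "(\<Sum>l\<in>L. b e l * y' l) = y' e" using b e x'y'(2) by simp
        ultimately show ?thesis unfolding had by (simp add: G_def hadamard_def)
      qed
      then have "p (\<lambda>e. G e (case_sum x' y')) = p (hadamard x y)" by (rule poly_fun_cong[OF p(1)])
      then show ?thesis using p(3) by simp
    qed
    have q: "(\<lambda>z. z e0) \<in> poly_fun J" using J(2) by (rule poly_fun.coord)
    have "p z * z e0 = 0" for z
      using alg[unfolded alg_indep_def, rule_format, OF poly_fun.mult[OF p(1) q]] 0 by blast
    then have "(\<forall>z\<in>UNIV. p z = 0) \<or> (\<forall>z::'a \<Rightarrow> complex\<in>UNIV. z e0 = 0)"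
      by (intro subspace_poly_fun_no_zero_divisors[OF cvec.subspace_UNIV p(1) q])
    moreover have "\<not> (\<forall>z::'a \<Rightarrow> complex\<in>UNIV. z e0 = 0)" by (auto intro!: exI[of _ "\<lambda>_. 1"])
    ultimately show False using p(2) by blast
  qed
  then show ?thesis using that[OF K(2,3) L(1,2)] cardB by simp
qed

section \<open>Sufficiency of the rank condition\<close>

text \<open>A complex vector space is not a finite union of proper subspaces: a point outside the
  earlier subspaces is moved in the direction of a point outside the new one.\<close>

lemma subspace_avoid_finite_family:
  assumes Y: "cvec.subspace Y" and "finite F" "\<And>S. S \<in> F \<Longrightarrow> cvec.subspace S"
    and "\<And>S. S \<in> F \<Longrightarrow> \<not> Y \<subseteq> S"
  shows "\<exists>q\<in>Y. \<forall>S\<in>F. q \<notin> S"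
  using assms(2-)
proof (induction F)
  case empty
  then show ?case using cvec.subspace_0[OF Y] by blast
next
  case (insert S F)
  then obtain q where q: "q \<in> Y" "\<forall>S\<in>F. q \<notin> S" by auto
  obtain r where r: "r \<in> Y" "r \<notin> S" using insert.prems(2) by blast
  obtain b where "\<And>T. T \<in> insert S F \<Longrightarrow> q + cscale b r \<notin> T"
    by (rule ex_add_cscale_notin_family[of "insert S F" q r]) (use insert q r in auto)
  moreover have "q + cscale b r \<in> Y" using Y q r by (intro cvec.subspace_add cvec.subspace_scale)
  ultimately show ?case by blast
qed

text \<open>The vectors \<open>y e * u e + x e * v e\<close> in the conclusion, where \<open>u e\<close> and \<open>v e\<close> are the coordinate
  functionals of \<open>U\<close> and \<open>V\<close>, are the rows of the Jacobian matrix of the Hadamard product at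
  \<open>(x, y)\<close>. Each spans the intersection of the plane spanned by \<open>u e\<close> and \<open>v e\<close> with the hyperplane
  of functionals vanishing at \<open>(- x, y)\<close>.\<close>

lemma hadamard_jacobian_rows_independent:
  fixes U V :: "('e \<Rightarrow> complex) set"
  assumes U: "cvec.subspace U" and V: "cvec.subspace V" and I: "finite I"
    and rk: "\<And>J. J \<subseteq> I \<Longrightarrow> J \<noteq> {} \<Longrightarrow> \<exists>K L. K \<subseteq> J \<and> L \<subseteq> J \<and> coord_indep U K \<and> coord_indep V L \<and>
      Suc (card J) \<le> card K + card L"
  obtains x y where "x \<in> U" "y \<in> V"
    "\<And>c. (\<And>a b. a \<in> U \<Longrightarrow> b \<in> V \<Longrightarrow> (\<Sum>e\<in>I. c e * (y e * a e + x e * b e)) = 0) \<Longrightarrow> \<forall>e\<in>I. c e = 0"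
proof -
  \<comment> \<open>\<open>X\<close> is the direct sum of \<open>U\<close> and \<open>V\<close>,
    realized on the disjoint sum of the index types.\<close>
  define X where "X = {q :: 'e + 'e \<Rightarrow> complex. q \<circ> Inl \<in> U \<and> q \<circ> Inr \<in> V}"
  have X: "cvec.subspace X"
  proof (rule cvec.subspaceI)
    show "0 \<in> X" using cvec.subspace_0[OF U] cvec.subspace_0[OF V] by (simp add: X_def comp_def zero_fun_def)
    show "q + r \<in> X" if "q \<in> X" "r \<in> X" for q r
      using cvec.subspace_add[OF U, of "q \<circ> Inl" "r \<circ> Inl"] cvec.subspace_add[OF V, of "q \<circ> Inr" "r \<circ> Inr"] that
      by (simp add: X_def comp_def plus_fun_def)
    show "cscale c q \<in> X" if "q \<in> X" for c q
      using cvec.subspace_scale[OF U, of "q \<circ> Inl" c] cvec.subspace_scale[OF V, of "q \<circ> Inr" c] that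
      by (simp add: X_def comp_def cscale_def)
  qed
  have case_in: "case_sum a b \<in> X" if "a \<in> U" "b \<in> V" for a b
    using that by (simp add: X_def comp_def)
  define u v where "u e = coord_fun X (Inl e)" and "v e = coord_fun X (Inr e)" for e
  have indep_X: "coord_indep X (K <+> L)"
    if KL: "finite K" "finite L" "coord_indep U K" "coord_indep V L" for K L
    unfolding coord_indep_def
  proof (intro allI impI)
    fix c assume c: "\<forall>q\<in>X. (\<Sum>e\<in>K <+> L. c e * q e) = 0"
    have c': "(\<Sum>k\<in>K. c (Inl k) * a k) + (\<Sum>l\<in>L. c (Inr l) * b l) = 0" if "a \<in> U" "b \<in> V" for a b
      using c[rule_format, OF case_in[OF that]] KL(1,2) by (simp add: sum.Plus)
    have "(\<Sum>k\<in>K. c (Inl k) * a k) = 0" if "a \<in> U" for a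
      using c'[OF that cvec.subspace_0[OF V]] by simp
    moreover have "(\<Sum>l\<in>L. c (Inr l) * b l) = 0" if "b \<in> V" for b
      using c'[OF cvec.subspace_0[OF U] that] by simp
    ultimately have "\<forall>k\<in>K. c (Inl k) = 0" "\<forall>l\<in>L. c (Inr l) = 0"
      using spec[OF KL(3)[unfolded coord_indep_def], of "\<lambda>k. c (Inl k)"]
        spec[OF KL(4)[unfolded coord_indep_def], of "\<lambda>k. c (Inr k)"] by simp_all
    then show "\<forall>e\<in>K <+> L. c e = 0" by auto
  qed
  have rank: "rank_ge (u ` J \<union> v ` J) (Suc (card J))" if J: "J \<subseteq> I" "J \<noteq> {}" for J
  proof -
    obtain K L where KL: "K \<subseteq> J" "L \<subseteq> J" "coord_indep U K" "coord_indep V L"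
      "Suc (card J) \<le> card K + card L" using rk[OF J] by blast
    have fin: "finite K" "finite L" using KL J I finite_subset by metis+
    note ind = coord_indep_independent[OF _ indep_X[OF fin KL(3,4)]]
    have "coord_fun X ` (K <+> L) \<subseteq> u ` J \<union> v ` J"
      using KL(1,2) unfolding u_def v_def by auto
    then have "coord_fun X ` (K <+> L) \<subseteq> cvec.span (u ` J \<union> v ` J)"
      using cvec.span_superset by blast
    moreover have "card (coord_fun X ` (K <+> L)) = card K + card L"
      using ind(1) fin by (simp add: card_image card_Plus)
    ultimately show ?thesis
      unfolding rank_ge_def using ind(2) fin KL(5)
      by (intro exI[of _ "coord_fun X ` (K <+> L)"]) simp
  qed
  obtain \<beta> where \<beta>1: "\<forall>c. (\<Sum>e\<in>I. cscale (c e) (u e + cscale (\<beta> e) (v e))) = 0 \<longrightarrow> (\<forall>e\<in>I. c e = 0)"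
    and \<beta>2: "\<forall>f\<in>I. \<not> (u f \<in> cvec.span ((\<lambda>e. u e + cscale (\<beta> e) (v e)) ` I) \<and>
                            v f \<in> cvec.span ((\<lambda>e. u e + cscale (\<beta> e) (v e)) ` I))"
    by (rule generic_transversal[OF I rank])
  define w where "w e = u e + cscale (\<beta> e) (v e)" for e
  have fun_uv: "functional_on X (u e)" "functional_on X (v e)" for e
    unfolding u_def v_def by (rule functional_on_coord_fun[OF X])+
  have w: "w e q = q (Inl e) + \<beta> e * q (Inr e)" if "q \<in> X" for e q
    using that by (simp add: w_def u_def v_def coord_fun_def cscale_apply)
  define Y where "Y = {q \<in> X. \<forall>e\<in>I. q (Inl e) + \<beta> e * q (Inr e) = 0}"
  have Y: "cvec.subspace Y"
  proof (rule cvec.subspaceI)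
    show "0 \<in> Y" using cvec.subspace_0[OF X] by (simp add: Y_def)
    show "q + r \<in> Y" if qr: "q \<in> Y" "r \<in> Y" for q r
    proof -
      have eq: "(q + r) (Inl e) + \<beta> e * (q + r) (Inr e) =
        (q (Inl e) + \<beta> e * q (Inr e)) + (r (Inl e) + \<beta> e * r (Inr e))" for e
        by (simp add: algebra_simps)
      show ?thesis
        using qr cvec.subspace_add[OF X, of q r] unfolding Y_def mem_Collect_eq eq by simp
    qed
    show "cscale c q \<in> Y" if q: "q \<in> Y" for c q
    proof -
      have eq: "cscale c q (Inl e) + \<beta> e * cscale c q (Inr e) = c * (q (Inl e) + \<beta> e * q (Inr e))" for e
        by (simp add: cscale_apply algebra_simps)
      show ?thesis
        using q cvec.subspace_scale[OF X, of q c] unfolding Y_def mem_Collect_eq eq by simp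
    qed
  qed
  define Z where "Z f = {q :: 'e + 'e \<Rightarrow> complex. q (Inl f) = 0 \<and> q (Inr f) = 0}" for f
  have Z: "cvec.subspace (Z f)" for f
    by (rule cvec.subspaceI) (auto simp: Z_def cscale_apply)
  have YZ: "\<not> Y \<subseteq> Z f" if f: "f \<in> I" for f
  proof -
    \<comment> \<open>The second property of \<open>\<beta>\<close> leaves one of \<open>u f\<close>
      and \<open>v f\<close> outside the span of the \<open>w e\<close>, so it is nonzero somewhere
      on their common kernel \<open>Y\<close>.\<close>
    obtain g where g: "g \<in> {u f, v f}" "g \<notin> cvec.span (w ` I)"
      using bspec[OF \<beta>2 f] unfolding w_def by blast
    then have g_fun: "functional_on X g" using fun_uv by auto
    have w_fun: "functional_on X h" if h: "h \<in> w ` I" for h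
    proof -
      obtain e where "h = w e" using h by blast
      then show ?thesis unfolding w_def using fun_uv by (simp add: functional_on_add_cscale)
    qed
    obtain q where q: "q \<in> X" "\<forall>h\<in>w ` I. h q = 0" "g q \<noteq> 0"
      by (rule functional_separation[OF X finite_imageI[OF I] w_fun g_fun g(2)])
    then have "q \<in> Y" using w[OF q(1)] by (simp add: Y_def)
    moreover have "q \<notin> Z f" using q(3) g(1) by (auto simp: Z_def u_def v_def coord_fun_def split: if_splits)
    ultimately show ?thesis by blast
  qed
  have "\<exists>q\<in>Y. \<forall>S\<in>Z ` I. q \<notin> S"
    by (intro subspace_avoid_finite_family Y finite_imageI I) (use Z YZ in blast)+
  then obtain q where q: "q \<in> Y" "\<And>f. f \<in> I \<Longrightarrow> q \<notin> Z f" by blast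
  have qX: "q \<in> X" using q(1) unfolding Y_def by blast
  \<comment> \<open>The sign turns \<open>q (Inl e) + \<beta> e * q (Inr e) = 0\<close> into
    \<open>x e = \<beta> e * y e\<close>.\<close>
  define x y where "x = cscale (-1) (q \<circ> Inl)" and "y = q \<circ> Inr"
  have x_eq: "x e = \<beta> e * y e" and y_ne: "y e \<noteq> 0" if e: "e \<in> I" for e
  proof -
    have *: "q (Inl e) + \<beta> e * q (Inr e) = 0" using q(1) e unfolding Y_def by blast
    then show "x e = \<beta> e * y e" by (simp add: x_def y_def cscale_apply add_eq_0_iff)
    \<comment> \<open>If \<open>y e\<close> were zero, both coordinates of \<open>q\<close> at
      \<open>e\<close> would vanish, contrary to the choice outside \<open>Z e\<close>.\<close>
    show "y e \<noteq> 0" using * q(2)[OF e] by (auto simp: y_def Z_def)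
  qed
  show ?thesis
  proof (rule that[of x y])
    show "x \<in> U" unfolding x_def using qX U by (intro cvec.subspace_scale) (auto simp: X_def)
    show "y \<in> V" unfolding y_def using qX by (simp add: X_def)
    fix c assume c: "\<And>a b. a \<in> U \<Longrightarrow> b \<in> V \<Longrightarrow> (\<Sum>e\<in>I. c e * (y e * a e + x e * b e)) = 0"
    \<comment> \<open>Since \<open>x e = \<beta> e * y e\<close>, the Jacobian row at
      \<open>e\<close> is \<open>y e\<close> times \<open>w e\<close>, so a relation between the
      rows is one between the \<open>w e\<close>.\<close>
    have "(\<Sum>e\<in>I. cscale (c e * y e) (w e)) r = 0" for r
    proof (cases "r \<in> X")
      case True
      then have "r \<circ> Inl \<in> U" "r \<circ> Inr \<in> V" by (simp_all add: X_def)
      then have "(\<Sum>e\<in>I. c e * (y e * (r \<circ> Inl) e + x e * (r \<circ> Inr) e)) = 0"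
        by (rule c)
      moreover have "(\<Sum>e\<in>I. cscale (c e * y e) (w e)) r =
          (\<Sum>e\<in>I. c e * (y e * (r \<circ> Inl) e + x e * (r \<circ> Inr) e))"
        unfolding sum_fun_apply cscale_apply w[OF True]
        by (intro sum.cong) (auto simp: x_eq algebra_simps)
      ultimately show ?thesis by simp
    next
      case False
      then show ?thesis
        by (simp add: sum_fun_apply cscale_apply w_def u_def v_def coord_fun_def)
    qed
    then have "(\<Sum>e\<in>I. cscale (c e * y e) (w e)) = 0" by (simp add: fun_eq_iff)
    then have "\<forall>e\<in>I. c e * y e = 0" by (rule \<beta>1[folded w_def, THEN spec, THEN mp])
    then show "\<forall>e\<in>I. c e = 0" using y_ne by simp
  qed
qed

text \<open>The gradient is characterized by the chain rule along curves, coordinate by coordinate,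
  so that only derivatives in one complex variable occur.\<close>

definition has_gradient ::
    "'e set \<Rightarrow> (('e \<Rightarrow> complex) \<Rightarrow> complex) \<Rightarrow> ('e \<Rightarrow> ('e \<Rightarrow> complex) \<Rightarrow> complex) \<Rightarrow> bool" where
  "has_gradient S p D \<longleftrightarrow> (\<forall>z z' (t :: complex). (\<forall>e\<in>S. ((\<lambda>t. z t e) has_field_derivative z' e) (at t)) \<longrightarrow>
    ((\<lambda>t. p (z t)) has_field_derivative (\<Sum>e\<in>S. D e (z t) * z' e)) (at t))"

lemma has_gradientD:
  "has_gradient S p D \<Longrightarrow> (\<And>e. e \<in> S \<Longrightarrow> ((\<lambda>t. z t e) has_field_derivative z' e) (at t)) \<Longrightarrow>
    ((\<lambda>t. p (z t)) has_field_derivative (\<Sum>e\<in>S. D e (z t) * z' e)) (at t)"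
  unfolding has_gradient_def by simp

lemma poly_fun_has_gradient:
  assumes "p \<in> poly_fun S" "finite S"
  shows "\<exists>D. (\<forall>e\<in>S. D e \<in> poly_fun S) \<and> has_gradient S p D"
  using assms(1)
proof (induction rule: poly_fun.induct)
  case (const c)
  show ?case by (rule exI[of _ "\<lambda>_ _. 0"]) (auto simp: has_gradient_def intro: poly_fun.const)
next
  case (coord e)
  have "(\<Sum>f\<in>S. (if f = e then 1 else 0) * z' f) = z' e" for z' :: "'a \<Rightarrow> complex"
    using assms(2) coord by (simp add: if_distrib[of "\<lambda>a. a * _"] cong: if_cong)
  then show ?case using coord
    by (intro exI[of _ "\<lambda>f z. if f = e then 1 else 0"]) (auto simp: has_gradient_def intro: poly_fun.const)
next
  case (add p q)
  then obtain P Q where P: "\<forall>e\<in>S. P e \<in> poly_fun S" "has_gradient S p P"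
    and Q: "\<forall>e\<in>S. Q e \<in> poly_fun S" "has_gradient S q Q" by blast
  have "has_gradient S (\<lambda>z. p z + q z) (\<lambda>e z. P e z + Q e z)"
    unfolding has_gradient_def
  proof (intro allI impI)
    fix z z' and t :: complex assume z: "\<forall>e\<in>S. ((\<lambda>t. z t e) has_field_derivative z' e) (at t)"
    show "((\<lambda>t. p (z t) + q (z t)) has_field_derivative
        (\<Sum>e\<in>S. (P e (z t) + Q e (z t)) * z' e)) (at t)"
      unfolding distrib_right sum.distrib
      by (intro DERIV_add has_gradientD[OF P(2)] has_gradientD[OF Q(2)] bspec[OF z])
  qed
  moreover have "(\<lambda>z. P e z + Q e z) \<in> poly_fun S" if "e \<in> S" for e
    using P(1) Q(1) that by (intro poly_fun.add) auto
  ultimately show ?case by (intro exI[of _ "\<lambda>e z. P e z + Q e z"]) blast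
next
  case (mult p q)
  then obtain P Q where P: "\<forall>e\<in>S. P e \<in> poly_fun S" "has_gradient S p P"
    and Q: "\<forall>e\<in>S. Q e \<in> poly_fun S" "has_gradient S q Q" by blast
  have "has_gradient S (\<lambda>z. p z * q z) (\<lambda>e z. P e z * q z + Q e z * p z)"
    unfolding has_gradient_def
  proof (intro allI impI)
    fix z z' and t :: complex assume z: "\<forall>e\<in>S. ((\<lambda>t. z t e) has_field_derivative z' e) (at t)"
    have "(\<Sum>e\<in>S. (P e (z t) * q (z t) + Q e (z t) * p (z t)) * z' e) =
      (\<Sum>e\<in>S. P e (z t) * z' e) * q (z t) + (\<Sum>e\<in>S. Q e (z t) * z' e) * p (z t)"
      by (simp add: sum_distrib_right sum_distrib_left sum.distrib[symmetric] algebra_simps)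
    then show "((\<lambda>t. p (z t) * q (z t)) has_field_derivative
        (\<Sum>e\<in>S. (P e (z t) * q (z t) + Q e (z t) * p (z t)) * z' e)) (at t)"
      using DERIV_mult[OF has_gradientD[OF P(2) bspec[OF z]] has_gradientD[OF Q(2) bspec[OF z]]] by simp
  qed
  moreover have "(\<lambda>z. P e z * q z + Q e z * p z) \<in> poly_fun S" if "e \<in> S" for e
    using P(1) Q(1) that mult.hyps by (intro poly_fun.add poly_fun.mult) auto
  ultimately show ?case by (intro exI[of _ "\<lambda>e z. P e z * q z + Q e z * p z"]) blast
qed

text \<open>Vectors of polynomials that are linearly independent at \<open>0\<close> are linearly independent over
  \<open>\<complex>[t]\<close>; this extends independence at one point of a line to a generic point.\<close>

lemma poly_relation_zero:
  fixes Q :: "'s \<Rightarrow> 'e \<Rightarrow> complex poly"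
  assumes indep: "\<And>c. (\<And>s. s \<in> A \<Longrightarrow> (\<Sum>e\<in>I. c e * poly (Q s e) 0) = 0) \<Longrightarrow> \<forall>e\<in>I. c e = 0"
    and rel: "\<And>s. s \<in> A \<Longrightarrow> (\<Sum>e\<in>I. C e * Q s e) = 0" and e: "e \<in> I"
  shows "C e = 0"
proof -
  \<comment> \<open>Evaluation at \<open>0\<close> shows that the constant terms vanish; dividing
    the relation by the variable then moves on to the next coefficient.\<close>
  have "coeff (C e) n = 0" for n
    using rel e
  proof (induction n arbitrary: C e)
    case (0 C)
    have "(\<Sum>e\<in>I. poly (C e) 0 * poly (Q s e) 0) = 0" if "s \<in> A" for s
      using arg_cong[OF 0(1)[OF that], of "\<lambda>p. poly p 0"] by (simp add: poly_sum)
    then show ?case using indep[of "\<lambda>e. poly (C e) 0"] 0(2) by (simp add: poly_0_coeff_0)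
  next
    case (Suc n C)
    have "(\<Sum>e\<in>I. poly (C e) 0 * poly (Q s e) 0) = 0" if "s \<in> A" for s
      using arg_cong[OF Suc.prems(1)[OF that], of "\<lambda>p. poly p 0"] by (simp add: poly_sum)
    then have "\<forall>e\<in>I. poly (C e) 0 = 0" by (intro indep)
    then have "\<forall>e\<in>I. \<exists>q. C e = [:0, 1:] * q"
      by (simp add: poly_eq_0_iff_dvd dvd_def)
    then have "\<exists>C'. \<forall>e\<in>I. C e = [:0, 1:] * C' e" by (rule bchoice)
    then obtain C' where C': "\<And>e. e \<in> I \<Longrightarrow> C e = [:0, 1:] * C' e" by auto
    have "(\<Sum>e\<in>I. C' e * Q s e) = 0" if s: "s \<in> A" for s
    proof -
      have "[:0, 1:] * (\<Sum>e\<in>I. C' e * Q s e) = (\<Sum>e\<in>I. C e * Q s e)"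
        unfolding sum_distrib_left by (intro sum.cong refl) (simp only: C' mult.assoc)
      then have "[:0, 1:] * (\<Sum>e\<in>I. C' e * Q s e) = 0" using Suc.prems(1)[OF s] by simp
      then show ?thesis unfolding mult_eq_0_iff by simp
    qed
    then have "coeff (C' e) n = 0" using Suc.IH Suc.prems(2) by blast
    then show ?case using C'[OF Suc.prems(2)] by simp
  qed
  then show ?thesis by (simp add: poly_eq_iff)
qed

text \<open>On the line \<open>cscale t w\<close>, the derivative of \<open>P\<close> comes from the
  directional derivative \<open>p'\<close>, which again vanishes on \<open>H\<close>. By induction
  on the degree a nonconstant \<open>P\<close> would have derivative zero; a constant
  \<open>P\<close> is zero because \<open>0 \<in> H\<close>.\<close>

lemma alg_indep_if_derivative_closed:
  fixes H :: "('e \<Rightarrow> complex) set"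
  assumes I: "finite I" and 0: "0 \<in> H"
    and closed: "\<And>p D e z. p \<in> poly_fun I \<Longrightarrow> \<forall>z\<in>H. p z = 0 \<Longrightarrow> \<forall>e\<in>I. D e \<in> poly_fun I \<Longrightarrow>
      has_gradient I p D \<Longrightarrow> e \<in> I \<Longrightarrow> z \<in> H \<Longrightarrow> D e z = 0"
  shows "alg_indep H I"
  unfolding alg_indep_def
proof (intro ballI impI allI)
  fix p w assume "p \<in> poly_fun I" "\<forall>z\<in>H. p z = 0"
  moreover obtain P where "\<And>t. p (cscale t w) = poly P t"
    using poly_fun_line[OF \<open>p \<in> poly_fun I\<close>, of 0 w] by auto
  ultimately have "P = 0"
  proof (induction "degree P" arbitrary: p P rule: less_induct)
    case less
    obtain D where D: "\<forall>e\<in>I. D e \<in> poly_fun I" "has_gradient I p D"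
      using poly_fun_has_gradient[OF less.prems(1) I] by blast
    have D0: "D e z = 0" if "e \<in> I" "z \<in> H" for e z
      by (rule closed[OF less.prems(1,2) D that])
    define p' where "p' z = (\<Sum>e\<in>I. D e z * w e)" for z
    have p': "p' \<in> poly_fun I" unfolding p'_def[abs_def]
      using D(1) by (intro poly_fun_sum poly_fun.mult poly_fun.const I) auto
    have p'0: "\<forall>z\<in>H. p' z = 0" using D0 by (simp add: p'_def)
    have p'_line: "p' (cscale t w) = poly (pderiv P) t" for t
    proof (rule DERIV_unique)
      have "((\<lambda>t. p (cscale t w)) has_field_derivative (\<Sum>e\<in>I. D e (cscale t w) * w e)) (at t)"
        by (rule has_gradientD[OF D(2)]) (auto simp: cscale_apply intro!: derivative_eq_intros)
      then show "((\<lambda>t. p (cscale t w)) has_field_derivative p' (cscale t w)) (at t)"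
        by (simp add: p'_def)
      show "((\<lambda>t. p (cscale t w)) has_field_derivative poly (pderiv P) t) (at t)"
        unfolding less.prems(3) by (rule poly_DERIV)
    qed
    have P0: "poly P 0 = 0" using less.prems(2) 0 less.prems(3)[of 0] by simp
    show ?case
    proof (cases "degree P = 0")
      case True
      then show ?thesis using P0 by (auto elim: degree_eq_zeroE)
    next
      case False
      then have "degree (pderiv P) < degree P" by (simp add: degree_pderiv)
      then have "pderiv P = 0" by (rule less.hyps[OF _ p' p'0 p'_line])
      then show ?thesis using False by (simp add: pderiv_eq_0_iff)
    qed
  qed
  then show "p w = 0"
    using \<open>\<And>t. p (cscale t w) = poly P t\<close>[of 1] by simp
qed

text \<open>Differentiation shows that the partial derivatives of \<open>p\<close> are the
  coefficients of a linear relation between the Jacobian rows. On the line from a point with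
  independent rows to the given point this is a relation over \<open>\<complex>[t]\<close> between
  rows independent at \<open>t = 0\<close>, so the partial derivatives vanish on the whole
  line.\<close>

lemma alg_indep_hadamard:
  fixes U V :: "('e \<Rightarrow> complex) set"
  assumes U: "cvec.subspace U" and V: "cvec.subspace V" and I: "finite I"
    and rk: "\<And>J. J \<subseteq> I \<Longrightarrow> J \<noteq> {} \<Longrightarrow> \<exists>K L. K \<subseteq> J \<and> L \<subseteq> J \<and> coord_indep U K \<and> coord_indep V L \<and>
      Suc (card J) \<le> card K + card L"
  shows "alg_indep {hadamard x y | x y. x \<in> U \<and> y \<in> V} I" (is "alg_indep ?H I")
proof (rule alg_indep_if_derivative_closed[OF I])
  have "hadamard 0 0 = (0 :: 'e \<Rightarrow> complex)" by (simp add: hadamard_def zero_fun_def)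
  then show "0 \<in> ?H"
    using cvec.subspace_0[OF U] cvec.subspace_0[OF V] by force
next
  fix p D e0 z
  assume p0: "\<forall>z\<in>?H. p z = 0" and D: "\<forall>e\<in>I. D e \<in> poly_fun I"
    and der: "has_gradient I p D"
    and e0: "e0 \<in> I" and "z \<in> ?H"
  then obtain x1 y1 where xy1: "x1 \<in> U" "y1 \<in> V" "z = hadamard x1 y1" by blast
  obtain x0 y0 where xy0: "x0 \<in> U" "y0 \<in> V"
    and ind: "\<And>c. (\<And>a b. a \<in> U \<Longrightarrow> b \<in> V \<Longrightarrow> (\<Sum>e\<in>I. c e * (y0 e * a e + x0 e * b e)) = 0) \<Longrightarrow> \<forall>e\<in>I. c e = 0"
    using hadamard_jacobian_rows_independent[OF U V I rk] by blast
  \<comment> \<open>At \<open>t = 0\<close> the pair is the generic \<open>(x0, y0)\<close>, at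
    \<open>t = 1\<close> the given \<open>(x1, y1)\<close>.\<close>
  define x where "x t = x0 + cscale t (x1 - x0)" for t
  define y where "y t = y0 + cscale t (y1 - y0)" for t
  have xU: "x t \<in> U" for t unfolding x_def
    using U xy0 xy1 by (intro cvec.subspace_add cvec.subspace_scale cvec.subspace_diff)
  have yV: "y t \<in> V" for t unfolding y_def
    using V xy0 xy1 by (intro cvec.subspace_add cvec.subspace_scale cvec.subspace_diff)
  define X where "X e = [:x0 e, x1 e - x0 e:]" for e
  define Y where "Y e = [:y0 e, y1 e - y0 e:]" for e
  have XY: "x t e = poly (X e) t" "y t e = poly (Y e) t" for t e
    by (simp_all add: x_def y_def X_def Y_def cscale_apply)
  have "\<exists>C. \<forall>t. D e (hadamard (x t) (y t)) = poly C t" if e: "e \<in> I" for e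
  proof (rule poly_fun_curve[of "D e" I "\<lambda>t. hadamard (x t) (y t)"])
    show "D e \<in> poly_fun I" using D e by blast
    show "\<exists>q. \<forall>t. hadamard (x t) (y t) f = poly q t" for f
      by (rule exI[of _ "X f * Y f"]) (simp add: hadamard_def XY)
  qed
  then have "\<exists>C. \<forall>e\<in>I. \<forall>t. D e (hadamard (x t) (y t)) = poly (C e) t" by (intro bchoice ballI)
  then obtain C where C: "\<And>e t. e \<in> I \<Longrightarrow> D e (hadamard (x t) (y t)) = poly (C e) t" by auto
  \<comment> \<open>\<open>Q (a, b) e\<close> is the Jacobian row of \<open>e\<close> along the
    line, applied to the direction \<open>(a, b)\<close>.\<close>
  define Q where "Q = (\<lambda>(a, b) e. smult (a e) (Y e) + smult (b e) (X e))"
  have rel: "(\<Sum>e\<in>I. C e * Q s e) = 0" if s: "s \<in> U \<times> V" for s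
  proof -
    obtain a b where ab: "s = (a, b)" "a \<in> U" "b \<in> V" using s by blast
    have "poly (\<Sum>e\<in>I. C e * Q s e) t = 0" for t
    proof -
      \<comment> \<open>Moving in the direction \<open>(a, b)\<close> stays inside \<open>U\<close>
        and \<open>V\<close>, so \<open>p\<close> is constantly zero and its derivative at
        \<open>r = 0\<close> is the desired relation.\<close>
      define \<zeta> where "\<zeta> r = hadamard (x t + cscale r a) (y t + cscale r b)" for r
      have "p (\<zeta> r) = 0" for r
      proof -
        have "x t + cscale r a \<in> U" "y t + cscale r b \<in> V"
          using U V xU yV ab by (auto intro: cvec.subspace_add cvec.subspace_scale)
        then show ?thesis using p0 unfolding \<zeta>_def by blast
      qed
      moreover have "((\<lambda>r. p (\<zeta> r)) has_field_derivative
          (\<Sum>e\<in>I. D e (\<zeta> 0) * (a e * y t e + b e * x t e))) (at 0)"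
        by (rule has_gradientD[OF der]) (auto simp: \<zeta>_def hadamard_def cscale_apply intro!: derivative_eq_intros)
      ultimately have "(\<Sum>e\<in>I. D e (\<zeta> 0) * (a e * y t e + b e * x t e)) = 0"
        using DERIV_unique[OF _ DERIV_const] by fastforce
      moreover have "\<zeta> 0 = hadamard (x t) (y t)" by (simp add: \<zeta>_def)
      ultimately show ?thesis by (simp add: poly_sum C Q_def ab(1) XY)
    qed
    then show ?thesis by (rule poly_eq_0_if_all)
  qed
  have "C e0 = 0"
  proof (rule poly_relation_zero[where A = "U \<times> V" and Q = Q, OF _ rel e0])
    fix c assume c: "\<And>s. s \<in> U \<times> V \<Longrightarrow> (\<Sum>e\<in>I. c e * poly (Q s e) 0) = 0"
    show "\<forall>e\<in>I. c e = 0"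
    proof (rule ind)
      show "(\<Sum>e\<in>I. c e * (y0 e * a e + x0 e * b e)) = 0" if "a \<in> U" "b \<in> V" for a b
        using c[of "(a, b)"] that by (simp add: Q_def X_def Y_def mult_ac)
    qed
  qed
  moreover have "x 1 = x1" "y 1 = y1" by (simp_all add: x_def y_def)
  ultimately show "D e0 z = 0" using C[OF e0, of 1] xy1(3) by simp
qed

section \<open>Comparison of the independent sets\<close>

theorem theorem3p1:
  fixes E :: "'e set" and U V :: "('e \<Rightarrow> complex) set"
  assumes "fin_dim_subspace E U" and "fin_dim_subspace E V"
    and "\<And>e. e \<in> E \<Longrightarrow> \<not> U \<subseteq> coord_hyperplane E e"
    and "\<And>e. e \<in> E \<Longrightarrow> \<not> V \<subseteq> coord_hyperplane E e"
  shows "algebraic_matroid E (hadamard_variety E U V) =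
    submodular_matroid E
      (\<lambda>S. rank_fun (algebraic_matroid E U) S + rank_fun (algebraic_matroid E V) S - 1)"
proof -
  have U: "cvec.subspace U" "U \<subseteq> cspace E" and V: "cvec.subspace V"
    using assms(1,2) unfolding fin_dim_subspace_def by blast+
  define H where "H = {hadamard x y | x y. x \<in> U \<and> y \<in> V}"
  have H_cspace: "H \<subseteq> cspace E"
    using U(2) by (auto simp: H_def hadamard_def cspace_def)
  have "H \<noteq> {}" unfolding H_def using cvec.subspace_0[OF U(1)] cvec.subspace_0[OF V] by blast
  then have "hadamard_variety E U V \<noteq> {}"
    using closure_of_subset[of H "zariski E"] H_cspace unfolding hadamard_variety_def H_def by auto
  note indep_sets = indep_sets_algebraic_matroid[OF this, of E]
  have "alg_indep (hadamard_variety E U V) I \<longleftrightarrow> alg_indep H I" if "I \<subseteq> E" for I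
    using alg_indep_zariski_closure[OF that H_cspace] unfolding hadamard_variety_def H_def .
  then have indep: "indep_sets (algebraic_matroid E (hadamard_variety E U V)) =
      {I. I \<subseteq> E \<and> finite I \<and> alg_indep H I}"
    unfolding indep_sets by auto
  let ?r = "\<lambda>W. rank_fun (algebraic_matroid E W)"
  have "alg_indep H I \<longleftrightarrow> (\<forall>J. J \<subseteq> I \<and> J \<noteq> {} \<longrightarrow> int (card J) \<le> ?r U J + ?r V J - 1)"
    if I: "I \<subseteq> E" "finite I" for I
  proof (intro iffI allI impI)
    fix J assume alg: "alg_indep H I" and J: "J \<subseteq> I \<and> J \<noteq> {}"
    have fin: "finite J" "J \<subseteq> E" using J I finite_subset[of J I] by blast+
    obtain e where e: "e \<in> J" using J by blast
    \<comment> \<open>As \<open>U\<close> lies in no coordinate hyperplane, some \<open>x\<close>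
      can be rescaled to \<open>x e = 1\<close>.\<close>
    then obtain x where x: "x \<in> U" "x e \<noteq> 0"
      using assms(3)[of e] fin(2) U(2) unfolding coord_hyperplane_def by blast
    have algJ: "alg_indep {hadamard x y | x y. x \<in> U \<and> y \<in> V} J"
      using alg_indep_subset[OF alg] J unfolding H_def by blast
    obtain K L where KL: "K \<subseteq> J" "coord_indep U K" "L \<subseteq> J" "coord_indep V L"
      "Suc (card J) \<le> card K + card L"
      by (rule alg_indep_hadamard_card_le[OF U(1) V fin(1) e x algJ])
    show "int (card J) \<le> ?r U J + ?r V J - 1"
      using coord_indep_rank_fun(1)[OF U(1) fin KL(1,2)] coord_indep_rank_fun(1)[OF V fin KL(3,4)] KL(5)
      by linarith
  next
    assume bound: "\<forall>J. J \<subseteq> I \<and> J \<noteq> {} \<longrightarrow> int (card J) \<le> ?r U J + ?r V J - 1"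
    show "alg_indep H I"
      unfolding H_def
    proof (rule alg_indep_hadamard[OF U(1) V I(2)])
      fix J assume J: "J \<subseteq> I" "J \<noteq> {}"
      have fin: "finite J" "J \<subseteq> E" using J I finite_subset[of J I] by blast+
      obtain K where K: "K \<subseteq> J" "coord_indep U K" "int (card K) = ?r U J"
        using coord_indep_rank_fun(2)[OF U(1) fin] by blast
      obtain L where L: "L \<subseteq> J" "coord_indep V L" "int (card L) = ?r V J"
        using coord_indep_rank_fun(2)[OF V fin] by blast
      have "int (card J) \<le> ?r U J + ?r V J - 1" using bound J by blast
      then have "Suc (card J) \<le> card K + card L" using K(3) L(3) by linarith
      then show "\<exists>K L. K \<subseteq> J \<and> L \<subseteq> J \<and> coord_indep U K \<and> coord_indep V L \<and>
          Suc (card J) \<le> card K + card L" using K L by blast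
    qed
  qed
  \<comment> \<open>For \<open>I = {}\<close> the rank condition is vacuous, in agreement with the
    separate clause \<open>I = {}\<close>.\<close>
  then have "indep_sets (algebraic_matroid E (hadamard_variety E U V)) =
      {I. I \<subseteq> E \<and> (I = {} \<or> finite I \<and>
        (\<forall>J. J \<subseteq> I \<and> J \<noteq> {} \<longrightarrow> int (card J) \<le> ?r U J + ?r V J - 1))}"
    unfolding indep by auto
  then show ?thesis
    unfolding indep_sets_def submodular_matroid_def algebraic_matroid_def by simp
qed

end
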